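(* Let $\mathcal C\subset\mathbb{P}^{n-1}$ be a real polyhedral cone, let $a\in\partial\mathcal C$, let $\mathcal H(a,I_1),\dots,\mathcal H(a,I_q)\in\Sigma_a$, let $\Lambda\subset\Sigma$ be a finite set of half-spaces whose apices are all distinct from $a$, put $\mathcal D=\bigcap_{\mathcal H'\in\Lambda}\mathcal H'$, and assume $\mathcal C=\mathcal D\cap\bigcap_{l=1}^q\mathcal H(a,I_l)$. Then: (i) $a\in\mathcal A$ if and only if the directed graph $\mathcal R(\mathcal D,a)$ is not strongly connected; (ii) when $a\in\mathcal A$, a subset $L\subset[q]$ is minimal (for inclusion) among the subsets satisfying $\tau(\Lambda\cup\{\mathcal H(a,I_l)\}_{l\in L})=\tau(\Lambda\cup\{\mathcal H(a,I_l)\}_{l\in[q]})=\Sigma$ if and only if the family $\{I_l\}_{l\in L}$ consists of precisely one element of each maximal strongly connected component of $\mathcal R(\mathcal D,a)$.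
   Context: Max-plus semiring $\mathbb{R}_{\max}=\mathbb{R}\cup\{-\infty\}$ with $\oplus=\max$, $\otimes=+$; on $\mathbb{R}_{\max}^n$, componentwise maximum and $\lambda x=(\lambda+x_1,\dots,\lambda+x_n)$. A real polyhedral cone is $\mathcal C=\{\lambda_1v^1\oplus\dots\oplus\lambda_pv^p:\lambda_r\in\mathbb{R}_{\max}\}$ with $v^1,\dots,v^p\in\mathbb{R}^n$, identified with its image in $\mathbb{P}^{n-1}=\mathbb{R}^n/\mathbb{R}(1,\dots,1)$ (usual topology); $\partial\mathcal C$ is its boundary. For $b\in\mathbb{R}^n$ and non-empty proper $K\subsetneq[n]$, the tropical half-space $\mathcal H(b,K)=\{x\in\mathbb{R}_{\max}^n\setminus\{(-\infty,\dots,-\infty)\}:\max_{i\in K}(x_i-b_i)\ge\max_{j\notin K}(x_j-b_j)\}$ (modulo adding constants) has apex $b\in\mathbb{P}^{n-1}$ and sectors $K$. $\Sigma$ is the set of all $\mathcal H(b,K)$ with $\mathcal C\subset\mathcal H(b,K)$ and $b\in\mathcal C$; $\tau(\Gamma)=\{\mathcal H\in\Sigma:\bigcap_{\mathcal H'\in\Gamma}\mathcal H'\subset\mathcal H\}$ for $\Gamma\subset\Sigma$ ($\tau(\emptyset)=\emptyset$); $\Sigma_b=\{\mathcal H(b,K):\mathcal C\subset\mathcal H(b,K)\}$; $\tau'(X)=\{b\in\partial\mathcal C:\Sigma_b\subset\tau(\bigcup_{c\in X}\Sigma_c)\}$ for $X\subset\partial\mathcal C$; $\mathcal A$ (the set of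 non-redundant apices) is the unique inclusion-minimal finite $X\subset\partial\mathcal C$ with $\tau'(X)=\partial\mathcal C$. A directed hypergraph on $[n]$ is a set of hyperarcs $(T,H)$ with $T,H\subset[n]$; a node $j$ is reachable from $I\subset[n]$ if $j\in I$ or there is a hyperarc $(T,H)$ with $j\in H$ and every $t\in T$ reachable from $I$; a set $J$ is reachable from $I$ if each element of $J$ is. The tangent directed hypergraph $\mathcal G(\Lambda,a)$ has, for each $\mathcal H(b,K)\in\Lambda$ that is active at $a$, i.e. $\max_{i\in K}(a_i-b_i)=\max_{j\notin K}(a_j-b_j)$, the hyperarc $(M,N)$ with $M=\operatorname{argmax}_{i\in K}(a_i-b_i)$ and $N=\operatorname{argmax}_{j\notin K}(a_j-b_j)$. The directed graph $\mathcal R(\mathcal D,a)$ has node set $E_a=\{[n]\}\cup\{I\subset[n]:\mathcal C\subset\mathcal H(a,I)\}$ and an arc from $I$ to $J$ iff $J$ is reachable from $I$ in $\mathcal G(\Lambda,a)$. Strongly connected components are partially ordered by $C\preceq C'$ iff $C'$ is reachable from $C$; maximal components are the maximal ones for this order. *)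

theory Defs
  imports "Graph_Theory.Digraph_Component" "HOL-Analysis.Analysis"
begin

text \<open>
  Vectors over the max-plus semiring are elements of \<open>ereal ^ 'n\<close> without entry \<open>\<infinity>\<close>;
  in \<^typ>\<open>ereal\<close> the sum of \<open>- \<infinity>\<close> and a max-plus scalar is \<open>- \<infinity>\<close>, and a supremum over
  an empty set is \<open>- \<infinity>\<close>, as required. The index set \<open>[n]\<close> is \<open>UNIV :: 'n set\<close>.
\<close>

definition maxplus_space :: "(ereal ^ 'n::finite) set" where
  "maxplus_space = {x. \<forall>i. x $ i \<noteq> \<infinity>}"

definition maxplus_zero :: "ereal ^ 'n::finite" where
  "maxplus_zero = (\<chi> i. - \<infinity>)"

definition real_vec :: "real ^ 'n::finite \<Rightarrow> ereal ^ 'n" where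
  "real_vec x = (\<chi> i. ereal (x $ i))"

definition trop_cone :: "nat \<Rightarrow> (nat \<Rightarrow> real ^ 'n::finite) \<Rightarrow> (ereal ^ 'n) set" where
  "trop_cone p v =
     {(\<chi> i. SUP r\<in>{1..p}. l r + real_vec (v r) $ i) |l. \<forall>r\<in>{1..p}. l r \<noteq> \<infinity>}"

definition real_polyhedral_cone :: "(ereal ^ 'n::finite) set \<Rightarrow> bool" where
  "real_polyhedral_cone C \<longleftrightarrow> (\<exists>p v. C = trop_cone p v)"


subsection \<open>Tropical projective space\<close>

definition proj_rel :: "real ^ 'n::finite \<Rightarrow> real ^ 'n \<Rightarrow> bool" where
  "proj_rel x y \<longleftrightarrow> (\<exists>c. \<forall>i. x $ i = c + y $ i)"

lemma equivp_proj_rel: "equivp (proj_rel :: real ^ 'n::finite \<Rightarrow> _)"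
proof (rule equivpI)
  show "reflp (proj_rel :: real ^ 'n \<Rightarrow> _)"
    by (rule reflpI) (auto simp: proj_rel_def intro: exI[of _ 0])
  show "symp (proj_rel :: real ^ 'n \<Rightarrow> _)"
  proof (rule sympI)
    fix x y :: "real ^ 'n" assume "proj_rel x y"
    then obtain c where "\<forall>i. x $ i = c + y $ i" by (auto simp: proj_rel_def)
    then have "\<forall>i. y $ i = - c + x $ i" by simp
    then show "proj_rel y x" unfolding proj_rel_def by blast
  qed
  show "transp (proj_rel :: real ^ 'n \<Rightarrow> _)"
  proof (rule transpI)
    fix x y z :: "real ^ 'n" assume "proj_rel x y" "proj_rel y z"
    then obtain c d where "\<forall>i. x $ i = c + y $ i" "\<forall>i. y $ i = d + z $ i"
      by (auto simp: proj_rel_def)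
    then have "\<forall>i. x $ i = (c + d) + z $ i" by simp
    then show "proj_rel x z" unfolding proj_rel_def by blast
  qed
qed

quotient_type 'n tproj = "real ^ ('n::finite)" / proj_rel
  by (rule equivp_proj_rel)

text \<open>The quotient topology.\<close>

instantiation tproj :: (finite) topological_space
begin

definition open_tproj :: "'a tproj set \<Rightarrow> bool" where
  "open_tproj U \<longleftrightarrow> open (abs_tproj -` U)"

instance
proof
  show "open (UNIV :: 'a tproj set)"
    by (simp add: open_tproj_def)
  show "open (S \<inter> T)" if "open S" "open T" for S T :: "'a tproj set"
    using that by (simp add: open_tproj_def vimage_Int open_Int)
  show "open (\<Union>K)" if "\<forall>S\<in>K. open S" for K :: "'a tproj set set"
    using that by (auto simp: open_tproj_def vimage_Union)
qed

end

text \<open>Since a real polyhedral cone has only real points besides \<^const>\<open>maxplus_zero\<close>, this is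
  its whole image in projective space.\<close>

definition proj_image :: "(ereal ^ 'n::finite) set \<Rightarrow> 'n tproj set" where
  "proj_image C = {abs_tproj x |x. real_vec x \<in> C}"

definition cone_boundary :: "(ereal ^ 'n::finite) set \<Rightarrow> 'n tproj set" where
  "cone_boundary C = frontier (proj_image C)"


subsection \<open>Tropical half-spaces\<close>

text \<open>The maximum of \<open>x\<^sub>i - b\<^sub>i\<close> over \<open>i \<in> K\<close>.\<close>

definition max_diff :: "ereal ^ 'n::finite \<Rightarrow> real ^ 'n \<Rightarrow> 'n set \<Rightarrow> ereal" where
  "max_diff x b K = (SUP i\<in>K. x $ i - real_vec b $ i)"

lemma ereal_shift_le_iff: "z + ereal c \<le> w + ereal c \<longleftrightarrow> z \<le> w"
  by (cases z; cases w) auto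

lemma SUP_ereal_shift:
  fixes f :: "'n::finite \<Rightarrow> ereal"
  shows "(SUP i\<in>K. f i + ereal c) = (SUP i\<in>K. f i) + ereal c"
proof -
  have "finite K" by simp
  then show ?thesis
  proof (induction K rule: finite_induct)
    case empty
    show ?case by (simp add: bot_ereal_def)
  next
    case (insert i K)
    then show ?case
      by (simp add: sup_max max_def ereal_shift_le_iff)
  qed
qed

lemma max_diff_shift_apex:
  fixes b b' :: "real ^ 'n::finite"
  assumes "\<forall>i. b $ i = c + b' $ i"
  shows "max_diff x b K = max_diff x b' K + ereal (- c)"
proof -
  have "x $ i - real_vec b $ i = x $ i - real_vec b' $ i + ereal (- c)" for i
    using assms by (cases "x $ i") (auto simp: real_vec_def)
  then show ?thesis
    unfolding max_diff_def by (simp only: SUP_ereal_shift)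
qed

lemma max_diff_shift_point:
  fixes a a' :: "real ^ 'n::finite"
  assumes "\<forall>i. a $ i = c + a' $ i"
  shows "max_diff (real_vec a) b K = max_diff (real_vec a') b K + ereal c"
proof -
  have "real_vec a $ i - real_vec b $ i = real_vec a' $ i - real_vec b $ i + ereal c" for i
    using assms by (simp add: real_vec_def)
  then show ?thesis
    unfolding max_diff_def by (simp only: SUP_ereal_shift)
qed

lemma ereal_shift_eq_iff: "z + ereal c = w + ereal c \<longleftrightarrow> z = w"
  by (cases z; cases w) auto

text \<open>The sectors of a half-space are a non-empty proper subset of the index set.\<close>

definition is_sectors :: "'n::finite set \<Rightarrow> bool" where
  "is_sectors K \<longleftrightarrow> K \<noteq> {} \<and> K \<noteq> UNIV"

text \<open>
  A half-space is a set of max-plus vectors closed under adding real constants. Its apex (as an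
  element of \<^typ>\<open>'n tproj\<close>) and its sectors are determined by this set as soon as the sectors
  are a non-empty proper subset, so families of half-spaces are treated as sets of such sets.
\<close>

lift_definition halfspace :: "'n::finite tproj \<Rightarrow> 'n set \<Rightarrow> (ereal ^ 'n) set" is
  "\<lambda>b K. {x \<in> maxplus_space - {maxplus_zero}. max_diff x b K \<ge> max_diff x b (- K)}"
proof -
  fix b b' :: "real ^ 'n"
  assume "proj_rel b b'"
  then obtain c where "\<forall>i. b $ i = c + b' $ i" by (auto simp: proj_rel_def)
  note * = max_diff_shift_apex[OF this]
  show "(\<lambda>K. {x \<in> maxplus_space - {maxplus_zero}. max_diff x b K \<ge> max_diff x b (- K)}) =
        (\<lambda>K. {x \<in> maxplus_space - {maxplus_zero}. max_diff x b' K \<ge> max_diff x b' (- K)})"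
    by (simp add: * ereal_shift_le_iff)
qed

text \<open>\<open>Sigma_at C b\<close>: all half-spaces with apex \<open>b\<close> containing \<open>C\<close>;
  \<open>Sigma_all C\<close>: all half-spaces containing \<open>C\<close> whose apex lies in \<open>C\<close>.\<close>

definition Sigma_at :: "(ereal ^ 'n::finite) set \<Rightarrow> 'n tproj \<Rightarrow> (ereal ^ 'n) set set" where
  "Sigma_at C b = {halfspace b K |K. is_sectors K \<and> C - {maxplus_zero} \<subseteq> halfspace b K}"

definition Sigma_all :: "(ereal ^ 'n::finite) set \<Rightarrow> (ereal ^ 'n) set set" where
  "Sigma_all C =
     {halfspace b K |b K. is_sectors K \<and> b \<in> proj_image C \<and> C - {maxplus_zero} \<subseteq> halfspace b K}"

text \<open>The convention \<open>\<tau>(\<emptyset>) = \<emptyset>\<close> holds automatically because \<open>\<Inter>{} = UNIV\<close>.\<close>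

definition tau :: "(ereal ^ 'n::finite) set \<Rightarrow> (ereal ^ 'n) set set \<Rightarrow> (ereal ^ 'n) set set" where
  "tau C \<Gamma> = {H \<in> Sigma_all C. \<Inter>\<Gamma> \<subseteq> H}"

lemma maxplus_zero_notin_halfspace: "maxplus_zero \<notin> halfspace b K"
  by transfer auto

lemma tau_empty: "tau C {} = {}"
  using maxplus_zero_notin_halfspace by (fastforce simp: tau_def Sigma_all_def)

definition tau' :: "(ereal ^ 'n::finite) set \<Rightarrow> 'n tproj set \<Rightarrow> 'n tproj set" where
  "tau' C X = {b \<in> cone_boundary C. Sigma_at C b \<subseteq> tau C (\<Union>c\<in>X. Sigma_at C c)}"

definition generates_boundary :: "(ereal ^ 'n::finite) set \<Rightarrow> 'n tproj set \<Rightarrow> bool" where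
  "generates_boundary C X \<longleftrightarrow> finite X \<and> X \<subseteq> cone_boundary C \<and> tau' C X = cone_boundary C"

definition nonredundant_apices :: "(ereal ^ 'n::finite) set \<Rightarrow> 'n tproj set" where
  "nonredundant_apices C =
     (THE X. generates_boundary C X \<and> (\<forall>Y. generates_boundary C Y \<and> Y \<subseteq> X \<longrightarrow> Y = X))"


subsection \<open>Tangent directed hypergraph and reachability\<close>

text \<open>A directed hypergraph is the set of its hyperarcs \<open>(T, H)\<close>.\<close>

inductive_set hyper_reach :: "('n set \<times> 'n set) set \<Rightarrow> 'n set \<Rightarrow> 'n set"
  for G :: "('n set \<times> 'n set) set" and I :: "'n set" where
  "j \<in> I \<Longrightarrow> j \<in> hyper_reach G I"
| "(T, H) \<in> G \<Longrightarrow> \<forall>t\<in>T. t \<in> hyper_reach G I \<Longrightarrow> j \<in> H \<Longrightarrow> j \<in> hyper_reach G I"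

lift_definition active_at :: "'n::finite tproj \<Rightarrow> 'n tproj \<Rightarrow> 'n set \<Rightarrow> bool" is
  "\<lambda>a b K. max_diff (real_vec a) b K = max_diff (real_vec a) b (- K)"
proof -
  fix a a' b b' :: "real ^ 'n"
  assume "proj_rel a a'" "proj_rel b b'"
  then obtain c d where "\<forall>i. a $ i = c + a' $ i" "\<forall>i. b $ i = d + b' $ i"
    by (auto simp: proj_rel_def)
  note * = max_diff_shift_point[OF this(1)] max_diff_shift_apex[OF this(2)]
  show "(\<lambda>K. max_diff (real_vec a) b K = max_diff (real_vec a) b (- K)) =
        (\<lambda>K. max_diff (real_vec a') b' K = max_diff (real_vec a') b' (- K))"
    by (simp only: * ereal_shift_eq_iff)
qed

text \<open>The set of all \<open>i \<in> K\<close> maximising \<open>a\<^sub>i - b\<^sub>i\<close>.\<close>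

lift_definition argmax_diff :: "'n::finite tproj \<Rightarrow> 'n tproj \<Rightarrow> 'n set \<Rightarrow> 'n set" is
  "\<lambda>a b K. {i. is_arg_max (\<lambda>i. a $ i - b $ i) (\<lambda>i. i \<in> K) i}"
  by (auto simp: proj_rel_def is_arg_max_linorder)

definition tangent_hypergraph ::
    "(ereal ^ 'n::finite) set set \<Rightarrow> 'n tproj \<Rightarrow> ('n set \<times> 'n set) set" where
  "tangent_hypergraph \<Lambda> a =
     {(argmax_diff a b K, argmax_diff a b (- K)) |b K.
        is_sectors K \<and> halfspace b K \<in> \<Lambda> \<and> active_at a b K}"

definition reach_nodes :: "(ereal ^ 'n::finite) set \<Rightarrow> 'n tproj \<Rightarrow> 'n set set" where
  "reach_nodes C a =
     {UNIV} \<union> {I. is_sectors I \<and> C - {maxplus_zero} \<subseteq> halfspace a I}"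

definition reach_digraph ::
    "(ereal ^ 'n::finite) set \<Rightarrow> (ereal ^ 'n) set set \<Rightarrow> 'n tproj
      \<Rightarrow> ('n set, 'n set \<times> 'n set) pre_digraph" where
  "reach_digraph C \<Lambda> a =
     \<lparr>verts = reach_nodes C a,
      arcs = {(I, J). I \<in> reach_nodes C a \<and> J \<in> reach_nodes C a \<and>
                      J \<subseteq> hyper_reach (tangent_hypergraph \<Lambda> a) I},
      tail = fst, head = snd\<rparr>"

definition scc_le :: "('v, 'e) pre_digraph \<Rightarrow> 'v set \<Rightarrow> 'v set \<Rightarrow> bool" where
  "scc_le G S S' \<longleftrightarrow> (\<exists>u\<in>S. \<exists>v\<in>S'. reachable G u v)"

definition maximal_sccs :: "('v, 'e) pre_digraph \<Rightarrow> 'v set set" where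
  "maximal_sccs G =
     {S \<in> pre_digraph.sccs_verts G. \<forall>S' \<in> pre_digraph.sccs_verts G. scc_le G S S' \<longrightarrow> S' = S}"

text \<open>The indexed family \<open>(I\<^sub>l)\<close>, \<open>l \<in> L\<close>, consists of exactly one element of each member of
  \<open>\<S>\<close>; two indices with the same set count as two elements.\<close>

definition one_of_each :: "(nat \<Rightarrow> 'v) \<Rightarrow> nat set \<Rightarrow> 'v set set \<Rightarrow> bool" where
  "one_of_each I L \<S> \<longleftrightarrow>
     (\<forall>l\<in>L. \<exists>S\<in>\<S>. I l \<in> S) \<and> (\<forall>S\<in>\<S>. \<exists>!l. l \<in> L \<and> I l \<in> S)"

text \<open>\<open>L\<close> is one of the index sets admitted in the minimisation: the half-spaces with apex \<open>a\<close>
  and sectors \<open>I\<^sub>l\<close>, \<open>l \<in> L\<close>, together with \<open>\<Lambda>\<close> generate the same as with all \<open>l \<le> q\<close>.\<close>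

definition sufficient_indices ::
    "(ereal ^ 'n::finite) set \<Rightarrow> (ereal ^ 'n) set set \<Rightarrow> 'n tproj \<Rightarrow> (nat \<Rightarrow> 'n set) \<Rightarrow> nat
      \<Rightarrow> nat set \<Rightarrow> bool" where
  "sufficient_indices C \<Lambda> a I q L \<longleftrightarrow>
     L \<subseteq> {1..q} \<and>
     tau C (\<Lambda> \<union> (\<lambda>l. halfspace a (I l)) ` L)
       = tau C (\<Lambda> \<union> (\<lambda>l. halfspace a (I l)) ` {1..q}) \<and>
     tau C (\<Lambda> \<union> (\<lambda>l. halfspace a (I l)) ` {1..q}) = Sigma_all C"

end

theory Submission
  imports Defs
begin

text \<open>
  Let \<open>peak x b\<close> be the set of indices where \<open>x - b\<close> is maximal; then \<open>x\<close> lies in the half-space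
  with apex \<open>b\<close> and sectors \<open>K\<close> iff \<open>peak x b\<close> meets \<open>K\<close>. If \<open>x \<in> \<D>\<close>, then the complement of
  \<open>peak x a\<close> is closed under the tangent hypergraph; conversely, if the complement of \<open>S \<noteq> \<emptyset>\<close> is
  closed, raising \<open>a\<close> slightly on \<open>S\<close> gives a point of \<open>\<D>\<close> with peak \<open>S\<close>. Hence
  \<open>\<D> \<inter> \<Inter>\<^sub>l \<H>(a, I\<^sub>l) \<subseteq> \<H>(a, J)\<close> iff \<open>J\<close> reaches \<open>[n]\<close> or some \<open>I\<^sub>l\<close>. This turns part (ii) into
  the fact that the minimal cofinal subsets of a finite preorder are the systems of representatives
  of its maximal classes.

  For part (i), every half-space containing \<open>\<C>\<close> whose apex lies in \<open>\<C>\<close> and differs from \<open>a\<close> has a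
  hyperarc under which the \<open>\<Lambda>\<close>-closed sets are already closed, so reachability does not depend on
  \<open>\<Lambda>\<close>. Consequently an apex that can be omitted from one generating set can be removed from
  every other one, the non-redundant apices are the intersection of all generating sets, and \<open>a\<close> is
  redundant iff every node reaches \<open>[n]\<close>.
\<close>

subsection \<open>Half-spaces and peaks\<close>

lemma tproj_rep: obtains \<beta> where "b = abs_tproj \<beta>"
  using Quotient_abs_rep[OF Quotient_tproj, of b] by metis

text \<open>These are the closed sectors of the max-plus hyperplane with apex \<open>b\<close> that
  contain \<open>x\<close>. Entries of \<open>x\<close> may be -\<infinity>, as half-spaces contain
  such points.\<close>

lift_definition peak :: "ereal ^ 'n::finite \<Rightarrow> 'n tproj \<Rightarrow> 'n set" is
  "\<lambda>x b. {i. \<forall>k. x $ k - real_vec b $ k \<le> x $ i - real_vec b $ i}"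
proof -
  fix x :: "ereal ^ 'n" and b b' :: "real ^ 'n"
  assume "proj_rel b b'"
  then obtain c where c: "\<forall>i. b $ i = c + b' $ i" by (auto simp: proj_rel_def)
  have "x $ i - real_vec b $ i = x $ i - real_vec b' $ i + ereal (- c)" for i
    using c by (cases "x $ i") (auto simp: real_vec_def)
  then show "{i. \<forall>k. x $ k - real_vec b $ k \<le> x $ i - real_vec b $ i} =
        {i. \<forall>k. x $ k - real_vec b' $ k \<le> x $ i - real_vec b' $ i}"
    by (simp add: ereal_shift_le_iff)
qed

lemma peak_real_vec:
  "peak (real_vec x) (abs_tproj b) = {i. \<forall>k. x $ k - b $ k \<le> x $ i - b $ i}"
  by (simp add: peak.abs_eq real_vec_def)

lemma finite_argmax_exists:
  fixes f :: "'a \<Rightarrow> 'b::linorder"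
  assumes "finite A" "A \<noteq> {}"
  obtains i where "i \<in> A" "\<And>k. k \<in> A \<Longrightarrow> f k \<le> f i"
proof -
  have "Max (f ` A) \<in> f ` A" using assms by (intro Max_in) auto
  then obtain i where "i \<in> A" "f i = Max (f ` A)" by auto
  then show thesis using that assms by (metis Max_ge finite_imageI imageI)
qed

lemma peak_nonempty: "peak x b \<noteq> {}"
proof -
  obtain \<beta> where "b = abs_tproj \<beta>" by (rule tproj_rep)
  moreover obtain i :: 'a where "\<And>k. x $ k - real_vec \<beta> $ k \<le> x $ i - real_vec \<beta> $ i"
    by (rule finite_argmax_exists[of UNIV "\<lambda>i. x $ i - real_vec \<beta> $ i"]) auto
  ultimately show ?thesis by (auto simp: peak.abs_eq)
qed

lemma max_diff_le_iff:
  assumes "B \<noteq> {}"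
  shows "max_diff x b A \<le> max_diff x b B \<longleftrightarrow>
    (\<forall>j\<in>A. \<exists>i\<in>B. x $ j - real_vec b $ j \<le> x $ i - real_vec b $ i)"
proof -
  let ?f = "\<lambda>i. x $ i - real_vec b $ i"
  obtain i where i: "i \<in> B" "\<And>k. k \<in> B \<Longrightarrow> ?f k \<le> ?f i"
    using finite_argmax_exists[of B ?f] assms by auto
  then have "max_diff x b B = ?f i"
    unfolding max_diff_def by (intro antisym SUP_least SUP_upper) auto
  then have "max_diff x b A \<le> max_diff x b B \<longleftrightarrow> (\<forall>j\<in>A. ?f j \<le> ?f i)"
    by (auto simp: max_diff_def SUP_le_iff)
  also have "\<dots> \<longleftrightarrow> (\<forall>j\<in>A. \<exists>i\<in>B. ?f j \<le> ?f i)" using i order_trans by blast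
  finally show ?thesis .
qed

lemma max_diff_Compl_le_iff:
  assumes "K \<noteq> {}"
  shows "max_diff x \<beta> (- K) \<le> max_diff x \<beta> K \<longleftrightarrow> peak x (abs_tproj \<beta>) \<inter> K \<noteq> {}"
proof
  let ?f = "\<lambda>i. x $ i - real_vec \<beta> $ i"
  assume *: "max_diff x \<beta> (- K) \<le> max_diff x \<beta> K"
  obtain i where i: "i \<in> K" "\<And>k. k \<in> K \<Longrightarrow> ?f k \<le> ?f i"
    using finite_argmax_exists[of K ?f] assms by auto
  have "?f k \<le> ?f i" for k
    using i * unfolding max_diff_le_iff[OF assms] by (meson ComplI order_trans)
  then show "peak x (abs_tproj \<beta>) \<inter> K \<noteq> {}" using i by (auto simp: peak.abs_eq)
next
  assume "peak x (abs_tproj \<beta>) \<inter> K \<noteq> {}"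
  then show "max_diff x \<beta> (- K) \<le> max_diff x \<beta> K"
    unfolding max_diff_le_iff[OF assms] by (auto simp: peak.abs_eq)
qed

lemma halfspace_eq_peak:
  assumes "is_sectors K"
  shows "halfspace b K = {x \<in> maxplus_space - {maxplus_zero}. peak x b \<inter> K \<noteq> {}}"
proof -
  obtain \<beta> where b: "b = abs_tproj \<beta>" by (rule tproj_rep)
  have "K \<noteq> {}" using assms by (simp add: is_sectors_def)
  then show ?thesis by (simp add: b halfspace.abs_eq max_diff_Compl_le_iff)
qed

lemma real_vec_in_space: "real_vec x \<in> maxplus_space - {maxplus_zero}"
  by (auto simp: maxplus_space_def maxplus_zero_def real_vec_def vec_eq_iff)

lemma real_vec_in_halfspace:
  assumes "is_sectors K"
  shows "real_vec x \<in> halfspace b K \<longleftrightarrow> peak (real_vec x) b \<inter> K \<noteq> {}"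
  using real_vec_in_space by (auto simp: halfspace_eq_peak[OF assms])

text \<open>For a representative \<beta> of \<open>b\<close>, \<open>x - \<beta>\<close> is the sum
  of \<open>x - \<alpha>\<close> and \<open>\<alpha> - \<beta>\<close>. If both summands are maximal
  at a common index, the sum is maximal exactly where both are.\<close>

lemma peak_eq_inter:
  assumes x: "x \<in> maxplus_space - {maxplus_zero}"
    and ne: "peak (real_vec \<alpha>) b \<inter> peak x (abs_tproj \<alpha>) \<noteq> {}"
  shows "peak x b = peak (real_vec \<alpha>) b \<inter> peak x (abs_tproj \<alpha>)"
proof -
  obtain \<beta> where b: "b = abs_tproj \<beta>" by (rule tproj_rep)
  obtain j where j: "\<And>k. \<alpha> $ k - \<beta> $ k \<le> \<alpha> $ j - \<beta> $ j"
     and j': "\<And>k. x $ k - real_vec \<alpha> $ k \<le> x $ j - real_vec \<alpha> $ j"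
    using ne by (auto simp: b peak_real_vec) (auto simp: peak.abs_eq)
  have fin: "x $ k \<noteq> \<infinity>" for k using x by (auto simp: maxplus_space_def)
  obtain k0 where k0: "x $ k0 \<noteq> - \<infinity>"
    using x by (auto simp: maxplus_zero_def vec_eq_iff)
  have "x $ j \<noteq> - \<infinity>"
  proof
    assume "x $ j = - \<infinity>"
    then show False using j'[of k0] k0 fin[of k0] by (cases "x $ k0") (auto simp: real_vec_def)
  qed
  then obtain r where r: "x $ j = ereal r" using fin[of j] by (cases "x $ j") auto
  have low: "x $ k - real_vec \<alpha> $ k \<le> ereal (r - \<alpha> $ j)" for k
    using j'[of k] r by (simp add: real_vec_def)
  \<comment> \<open>For a finite entry each membership is a single comparison of \<open>i\<close>
    with \<open>j\<close>. The comparison for \<beta> is the sum of the other two, each of which can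
    hold only with equality.\<close>
  have "i \<in> peak x b \<longleftrightarrow> i \<in> peak (real_vec \<alpha>) b \<inter> peak x (abs_tproj \<alpha>)" for i
  proof (cases "x $ i")
    case (real s)
    have "i \<in> peak x b \<longleftrightarrow> r - \<beta> $ j \<le> s - \<beta> $ i"
    proof
      assume "i \<in> peak x b"
      then have "x $ j - real_vec \<beta> $ j \<le> x $ i - real_vec \<beta> $ i" by (auto simp: b peak.abs_eq)
      then show "r - \<beta> $ j \<le> s - \<beta> $ i" using r real by (simp add: real_vec_def)
    next
      assume *: "r - \<beta> $ j \<le> s - \<beta> $ i"
      have "x $ k - real_vec \<beta> $ k \<le> x $ i - real_vec \<beta> $ i" for k
      proof (cases "x $ k")
        case (real t)
        then show ?thesis using low[of k] j[of k] * \<open>x $ i = ereal s\<close>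
          by (simp add: real_vec_def)
      next
        case PInf
        then show ?thesis using fin[of k] by simp
      next
        case MInf
        then show ?thesis by (simp add: real_vec_def)
      qed
      then show "i \<in> peak x b" by (auto simp: b peak.abs_eq)
    qed
    moreover have "i \<in> peak x (abs_tproj \<alpha>) \<longleftrightarrow> r - \<alpha> $ j \<le> s - \<alpha> $ i"
    proof
      assume "i \<in> peak x (abs_tproj \<alpha>)"
      then have "x $ j - real_vec \<alpha> $ j \<le> x $ i - real_vec \<alpha> $ i" by (auto simp: peak.abs_eq)
      then show "r - \<alpha> $ j \<le> s - \<alpha> $ i" using r real by (simp add: real_vec_def)
    next
      assume *: "r - \<alpha> $ j \<le> s - \<alpha> $ i"
      have "x $ k - real_vec \<alpha> $ k \<le> x $ i - real_vec \<alpha> $ i" for k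
      proof -
        have "ereal (r - \<alpha> $ j) \<le> x $ i - real_vec \<alpha> $ i"
          using * real by (simp add: real_vec_def)
        then show ?thesis using low[of k] by (rule order_trans[rotated])
      qed
      then show "i \<in> peak x (abs_tproj \<alpha>)" by (auto simp: peak.abs_eq)
    qed
    moreover have "i \<in> peak (real_vec \<alpha>) b \<longleftrightarrow> \<alpha> $ j - \<beta> $ j \<le> \<alpha> $ i - \<beta> $ i"
      using j by (auto simp: b peak_real_vec intro: order_trans)
    ultimately show ?thesis using j[of i] low[of i] real by (auto simp: real_vec_def)
  next
    case PInf
    then show ?thesis using fin[of i] by simp
  next
    case MInf
    have "i \<notin> peak x b"
    proof
      assume "i \<in> peak x b"
      then have "x $ j - real_vec \<beta> $ j \<le> x $ i - real_vec \<beta> $ i" by (auto simp: b peak.abs_eq)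
      then show False using MInf r by (simp add: real_vec_def)
    qed
    moreover have "i \<notin> peak x (abs_tproj \<alpha>)"
    proof
      assume "i \<in> peak x (abs_tproj \<alpha>)"
      then have "x $ j - real_vec \<alpha> $ j \<le> x $ i - real_vec \<alpha> $ i" by (auto simp: peak.abs_eq)
      then show False using MInf r by (simp add: real_vec_def)
    qed
    ultimately show ?thesis by simp
  qed
  then show ?thesis by blast
qed

section \<open>Small displacements of a point along a set of indices\<close>

definition bump :: "real ^ 'n::finite \<Rightarrow> 'n set \<Rightarrow> real \<Rightarrow> real ^ 'n" where
  "bump \<alpha> S \<epsilon> = (\<chi> i. if i \<in> S then \<alpha> $ i + \<epsilon> else \<alpha> $ i)"

lemma peak_bump_self:
  assumes "\<epsilon> > 0" "S \<noteq> {}"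
  shows "peak (real_vec (bump \<alpha> S \<epsilon>)) (abs_tproj \<alpha>) = S"
  using assms by (fastforce simp: peak_real_vec bump_def split: if_splits)

text \<open>If the peak of \<alpha> at \<open>b\<close> meets \<open>S\<close>, every positive
  displacement shrinks it to its part in \<open>S\<close>, where \<open>loc\<close> provides an
  index of \<open>K\<close>. Otherwise the raised indices start strictly below the maximum, and for
  small \<epsilon> they do not overtake an unraised maximal index in \<open>K\<close>.\<close>

lemma eventually_bump_in_halfspace:
  assumes K: "is_sectors K" and S: "S \<noteq> {}"
    and mem: "real_vec \<alpha> \<in> halfspace b K"
    and loc: "peak (real_vec \<alpha>) b \<inter> S \<noteq> {} \<Longrightarrow> peak (real_vec \<alpha>) b \<inter> S \<inter> K \<noteq> {}"
  shows "\<forall>\<^sub>F \<epsilon> in at_right 0. real_vec (bump \<alpha> S \<epsilon>) \<in> halfspace b K"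
proof (cases "peak (real_vec \<alpha>) b \<inter> S = {}")
  case False
  have "real_vec (bump \<alpha> S \<epsilon>) \<in> halfspace b K" if "\<epsilon> > 0" for \<epsilon>
  proof -
    note self = peak_bump_self[OF that S, of \<alpha>]
    have "peak (real_vec (bump \<alpha> S \<epsilon>)) b = peak (real_vec \<alpha>) b \<inter> S"
      using peak_eq_inter[OF real_vec_in_space, of \<alpha> b "bump \<alpha> S \<epsilon>"] False self by simp
    then show ?thesis using loc[OF False] by (auto simp: real_vec_in_halfspace[OF K])
  qed
  then show ?thesis by (auto simp: eventually_at_filter)
next
  case True
  obtain \<beta> where b: "b = abs_tproj \<beta>" by (rule tproj_rep)
  obtain i where i: "i \<in> peak (real_vec \<alpha>) b" "i \<in> K"
    using mem by (auto simp: real_vec_in_halfspace[OF K])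
  have "i \<notin> S" using True i by auto
  have "\<forall>\<^sub>F \<epsilon> in at_right 0. bump \<alpha> S \<epsilon> $ k - \<beta> $ k \<le> bump \<alpha> S \<epsilon> $ i - \<beta> $ i" for k
  proof (cases "k \<in> S")
    case False
    then show ?thesis using i \<open>i \<notin> S\<close> by (simp add: b peak_real_vec bump_def)
  next
    case kS: True
    then have "k \<notin> peak (real_vec \<alpha>) b" using True by auto
    then obtain m where "\<alpha> $ k - \<beta> $ k < \<alpha> $ m - \<beta> $ m"
      by (auto simp: b peak_real_vec not_le)
    also have "\<dots> \<le> \<alpha> $ i - \<beta> $ i" using i by (simp add: b peak_real_vec)
    finally have "(\<alpha> $ i - \<beta> $ i) - (\<alpha> $ k - \<beta> $ k) > 0" by simp
    then have "\<forall>\<^sub>F \<epsilon> in at_right 0. \<epsilon> < (\<alpha> $ i - \<beta> $ i) - (\<alpha> $ k - \<beta> $ k)"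
      unfolding eventually_at_right_field by blast
    then show ?thesis
      by (rule eventually_mono) (use kS \<open>i \<notin> S\<close> in \<open>auto simp: bump_def\<close>)
  qed
  then have "\<forall>\<^sub>F \<epsilon> in at_right 0. \<forall>k. bump \<alpha> S \<epsilon> $ k - \<beta> $ k \<le> bump \<alpha> S \<epsilon> $ i - \<beta> $ i"
    by (rule eventually_all_finite)
  then show ?thesis
    by (rule eventually_mono) (use i(2) in \<open>auto simp: real_vec_in_halfspace[OF K] b peak_real_vec\<close>)
qed

subsection \<open>Intersections of half-spaces near a point\<close>

text \<open>Pairs of apex and sectors are carried along because peaks refer to them; neither then
  has to be recovered from a half-space as a set of points.\<close>

definition halfspaces :: "('n::finite tproj \<times> 'n set) set \<Rightarrow> (ereal ^ 'n) set set" where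
  "halfspaces P = (\<lambda>(b, K). halfspace b K) ` P"

definition all_sectors :: "('n::finite tproj \<times> 'n set) set \<Rightarrow> bool" where
  "all_sectors P \<longleftrightarrow> (\<forall>(b, K)\<in>P. is_sectors K)"

text \<open>If \<open>peak (real_vec \<alpha>) b \<inter> K\<close> is non-empty, it is the tail of the hyperarc of \<open>(b, K)\<close>, and the
  head is the rest of the peak, which is empty precisely when the half-space is not active. No case
  distinction on activity is therefore needed.\<close>

definition tangent_closed ::
    "real ^ 'n::finite \<Rightarrow> ('n tproj \<times> 'n set) set \<Rightarrow> 'n set \<Rightarrow> bool" where
  "tangent_closed \<alpha> P R \<longleftrightarrow>
     (\<forall>(b, K)\<in>P. peak (real_vec \<alpha>) b \<inter> K \<subseteq> R \<longrightarrow> peak (real_vec \<alpha>) b \<subseteq> R)"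

lemma in_Inter_halfspaces: "x \<in> \<Inter>(halfspaces P) \<longleftrightarrow> (\<forall>(b, K)\<in>P. x \<in> halfspace b K)"
  by (auto simp: halfspaces_def)

text \<open>If \<open>peak (real_vec \<alpha>) b\<close> is not contained in the complement, it
  meets the peak of \<open>x\<close>. Then \<open>peak x b\<close> is the intersection of the two,
  and it meets \<open>K\<close> because \<open>x\<close> lies in the half-space.\<close>

lemma tangent_closed_Compl_peak:
  assumes P: "all_sectors P" and x: "x \<in> \<Inter>(halfspaces P)"
    and nz: "x \<in> maxplus_space - {maxplus_zero}"
  shows "tangent_closed \<alpha> P (- peak x (abs_tproj \<alpha>))"
  unfolding tangent_closed_def
proof (clarify)
  fix b K j
  assume bK: "(b, K) \<in> P"
    and sub: "peak (real_vec \<alpha>) b \<inter> K \<subseteq> - peak x (abs_tproj \<alpha>)"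
    and j: "j \<in> peak (real_vec \<alpha>) b" "j \<in> peak x (abs_tproj \<alpha>)"
  have "peak x b = peak (real_vec \<alpha>) b \<inter> peak x (abs_tproj \<alpha>)"
    using peak_eq_inter[OF nz] j by blast
  moreover have "peak x b \<inter> K \<noteq> {}"
  proof -
    have "is_sectors K" using P bK by (auto simp: all_sectors_def)
    moreover have "x \<in> halfspace b K" using x bK by (auto simp: halfspaces_def)
    ultimately show ?thesis by (simp add: halfspace_eq_peak)
  qed
  ultimately show False using sub by blast
qed

text \<open>Closedness of \<open>- S\<close> is, by contraposition, the local condition of
  \<open>eventually_bump_in_halfspace\<close> for each pair. Finiteness is asked of the half-spaces,
  not of the pairs, since each half-space contributes one threshold for \<epsilon>.\<close>

lemma bump_in_halfspaces:
  assumes P: "all_sectors P" and fin: "finite (halfspaces P)"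
    and \<alpha>: "real_vec \<alpha> \<in> \<Inter>(halfspaces P)"
    and cl: "tangent_closed \<alpha> P (- S)" and S: "S \<noteq> {}"
  obtains \<epsilon> where "\<epsilon> > 0" "real_vec (bump \<alpha> S \<epsilon>) \<in> \<Inter>(halfspaces P)"
proof -
  have "\<forall>\<^sub>F \<epsilon> in at_right 0. real_vec (bump \<alpha> S \<epsilon>) \<in> H" if H: "H \<in> halfspaces P" for H
  proof -
    obtain b K where bK: "(b, K) \<in> P" "H = halfspace b K"
      using H by (auto simp: halfspaces_def)
    have K: "is_sectors K" using P bK by (auto simp: all_sectors_def)
    have loc: "peak (real_vec \<alpha>) b \<inter> S \<inter> K \<noteq> {}" if "peak (real_vec \<alpha>) b \<inter> S \<noteq> {}"
      using cl bK(1) that unfolding tangent_closed_def by blast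
    have "real_vec \<alpha> \<in> halfspace b K" using \<alpha> H bK(2) by blast
    then show ?thesis
      unfolding bK(2) using loc by (rule eventually_bump_in_halfspace[OF K S])
  qed
  then have "\<forall>\<^sub>F \<epsilon> in at_right 0. \<forall>H\<in>halfspaces P. real_vec (bump \<alpha> S \<epsilon>) \<in> H"
    using fin by (simp add: eventually_ball_finite)
  moreover have "\<forall>\<^sub>F \<epsilon>::real in at_right 0. \<epsilon> > 0" by (rule eventually_at_right_less)
  ultimately have "\<forall>\<^sub>F \<epsilon> in at_right 0. \<epsilon> > 0 \<and> (\<forall>H\<in>halfspaces P. real_vec (bump \<alpha> S \<epsilon>) \<in> H)"
    by eventually_elim simp
  then obtain \<epsilon> where "\<epsilon> > 0 \<and> (\<forall>H\<in>halfspaces P. real_vec (bump \<alpha> S \<epsilon>) \<in> H)"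
    using eventually_happens' trivial_limit_at_right_real by blast
  then show thesis using that by blast
qed

section \<open>Tropical joins and comparison of two descriptions by half-spaces\<close>

lemma real_vec_in_halfspace_abs:
  assumes "is_sectors K"
  shows "real_vec x \<in> halfspace (abs_tproj \<beta>) K \<longleftrightarrow>
    (\<exists>i\<in>K. \<forall>k. x $ k - \<beta> $ k \<le> x $ i - \<beta> $ i)"
  by (auto simp: real_vec_in_halfspace[OF assms] peak_real_vec)

text \<open>After subtracting \<beta>, the maximum of the join is the larger of the two separate
  maxima, and each of these is attained in \<open>K\<close>.\<close>

lemma max_combination_in_halfspace:
  assumes K: "is_sectors K"
    and x: "real_vec x \<in> halfspace b K" and y: "real_vec y \<in> halfspace b K"
  shows "real_vec (\<chi> k. max (x $ k) (c + y $ k)) \<in> halfspace b K"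
proof -
  obtain \<beta> where b: "b = abs_tproj \<beta>" by (rule tproj_rep)
  obtain i where i: "i \<in> K" "\<And>k. x $ k - \<beta> $ k \<le> x $ i - \<beta> $ i"
    using x by (auto simp: b real_vec_in_halfspace_abs[OF K])
  obtain j where j: "j \<in> K" "\<And>k. y $ k - \<beta> $ k \<le> y $ j - \<beta> $ j"
    using y by (auto simp: b real_vec_in_halfspace_abs[OF K])
  show ?thesis
  proof (cases "x $ i - \<beta> $ i \<le> c + y $ j - \<beta> $ j")
    case True
    have "max (x $ k) (c + y $ k) - \<beta> $ k \<le> max (x $ j) (c + y $ j) - \<beta> $ j" for k
      using i(2)[of k] j(2)[of k] True by linarith
    then show ?thesis using j(1) by (auto simp: b real_vec_in_halfspace_abs[OF K])
  next
    case False
    have "max (x $ k) (c + y $ k) - \<beta> $ k \<le> max (x $ i) (c + y $ i) - \<beta> $ i" for k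
      using i(2)[of k] j(2)[of k] False by linarith
    then show ?thesis using i(1) by (auto simp: b real_vec_in_halfspace_abs[OF K])
  qed
qed

text \<open>At a common index \<open>\<alpha> - \<beta>\<close> takes both its maximum and its
  minimum, so it is constant and the two projective points agree.\<close>

lemma peak_disjoint:
  assumes "abs_tproj \<alpha> \<noteq> abs_tproj \<beta>"
  shows "peak (real_vec \<alpha>) (abs_tproj \<beta>) \<inter> peak (real_vec \<beta>) (abs_tproj \<alpha>) = {}"
proof (rule ccontr)
  assume "\<not> ?thesis"
  then obtain k where "\<And>j. \<alpha> $ j - \<beta> $ j \<le> \<alpha> $ k - \<beta> $ k" "\<And>j. \<beta> $ j - \<alpha> $ j \<le> \<beta> $ k - \<alpha> $ k"
    by (auto simp: peak_real_vec)
  then have "\<alpha> $ j = (\<alpha> $ k - \<beta> $ k) + \<beta> $ j" for j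
proof -
    show ?thesis using \<open>\<And>j. \<alpha> $ j - \<beta> $ j \<le> \<alpha> $ k - \<beta> $ k\<close>[of j]
      \<open>\<And>j. \<beta> $ j - \<alpha> $ j \<le> \<beta> $ k - \<alpha> $ k\<close>[of j] by linarith
  qed
  then have "proj_rel \<alpha> \<beta>" unfolding proj_rel_def by blast
  then show False using assms by (simp add: tproj.abs_eq_iff)
qed

text \<open>If \<open>R\<close> violated the conclusion, then raising \<open>\<alpha>\<close> by \<open>\<epsilon>\<close> off \<open>R\<close> and joining with the translate
  of the apex \<open>\<beta>\<close> whose maximal excess over \<open>\<alpha>\<close> is also \<open>\<epsilon>\<close> would give a point of the
  intersection outside the half-space: \<open>\<beta>\<close> brings the point into all half-spaces at \<open>\<alpha>\<close>, but
  since \<open>\<beta> \<noteq> \<alpha>\<close> it does not touch the indices that are critical for the half-space at \<open>\<beta>\<close>.\<close>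

lemma tangent_closed_at_containing_halfspace:
  assumes P: "all_sectors P" and fin: "finite (halfspaces P)"
    and \<alpha>: "real_vec \<alpha> \<in> \<Inter>(halfspaces P)"
    and \<beta>: "real_vec \<beta> \<in> \<Inter>(halfspaces P)"
    and \<J>: "\<And>J. J \<in> \<J> \<Longrightarrow> is_sectors J"
    and \<beta>\<J>: "\<And>J. J \<in> \<J> \<Longrightarrow> real_vec \<beta> \<in> halfspace (abs_tproj \<alpha>) J"
    and K: "is_sectors K"
    and sub: "\<Inter>(halfspaces P) \<inter> (\<Inter>J\<in>\<J>. halfspace (abs_tproj \<alpha>) J) \<subseteq> halfspace (abs_tproj \<beta>) K"
    and ne: "abs_tproj \<alpha> \<noteq> abs_tproj \<beta>"
    and cl: "tangent_closed \<alpha> P R"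
    and R: "peak (real_vec \<alpha>) (abs_tproj \<beta>) \<inter> K \<subseteq> R"
  shows "peak (real_vec \<alpha>) (abs_tproj \<beta>) \<subseteq> R"
proof (rule ccontr)
  let ?Z = "peak (real_vec \<alpha>) (abs_tproj \<beta>)" and ?S = "- R"
  let ?W = "peak (real_vec \<beta>) (abs_tproj \<alpha>)"
  assume "\<not> ?thesis"
  then have ZS: "?Z \<inter> ?S \<noteq> {}" by blast
  obtain \<epsilon> where \<epsilon>: "\<epsilon> > 0" and y: "real_vec (bump \<alpha> ?S \<epsilon>) \<in> \<Inter>(halfspaces P)"
    using bump_in_halfspaces[OF P fin \<alpha>, of ?S] cl ZS by auto
  obtain i where i: "\<And>k. \<beta> $ k - \<alpha> $ k \<le> \<beta> $ i - \<alpha> $ i"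
    using peak_nonempty[of "real_vec \<beta>" "abs_tproj \<alpha>"] by (auto simp: peak_real_vec)
  define c where "c = \<epsilon> - (\<beta> $ i - \<alpha> $ i)"
  define x where "x = (\<chi> k. max (bump \<alpha> ?S \<epsilon> $ k) (c + \<beta> $ k))"
  have W: "k \<in> ?W \<longleftrightarrow> c + \<beta> $ k - \<alpha> $ k = \<epsilon>" for k
  proof
    assume "k \<in> ?W"
    then have "\<beta> $ i - \<alpha> $ i \<le> \<beta> $ k - \<alpha> $ k" by (auto simp: peak_real_vec)
    then show "c + \<beta> $ k - \<alpha> $ k = \<epsilon>" using i[of k] by (simp add: c_def)
  next
    assume "c + \<beta> $ k - \<alpha> $ k = \<epsilon>"
    then have "\<beta> $ k - \<alpha> $ k = \<beta> $ i - \<alpha> $ i" by (simp add: c_def)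
    then show "k \<in> ?W" using i by (simp add: peak_real_vec)
  qed
  have xle: "x $ k - \<alpha> $ k \<le> \<epsilon>" for k
    using i[of k] \<epsilon> by (auto simp: x_def bump_def c_def max_def)
  have x_eq: "x $ k - \<alpha> $ k = \<epsilon> \<longleftrightarrow> k \<in> ?S \<union> ?W" for k
    using i[of k] \<epsilon> unfolding Un_iff W by (auto simp: x_def bump_def c_def max_def)
  have iW: "i \<in> ?W" using i by (simp add: peak_real_vec)
  have "k \<in> peak (real_vec x) (abs_tproj \<alpha>) \<longleftrightarrow> x $ k - \<alpha> $ k = \<epsilon>" for k
  proof -
    have xi: "x $ i - \<alpha> $ i = \<epsilon>" using x_eq[of i] iW by blast
    show ?thesis
    proof
      assume "k \<in> peak (real_vec x) (abs_tproj \<alpha>)"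
      then have "x $ i - \<alpha> $ i \<le> x $ k - \<alpha> $ k" by (auto simp: peak_real_vec)
      then show "x $ k - \<alpha> $ k = \<epsilon>" using xi xle[of k] by linarith
    next
      assume "x $ k - \<alpha> $ k = \<epsilon>"
      then show "k \<in> peak (real_vec x) (abs_tproj \<alpha>)" using xle by (simp add: peak_real_vec)
    qed
  qed
  then have px: "peak (real_vec x) (abs_tproj \<alpha>) = ?S \<union> ?W" using x_eq by blast
  have "real_vec x \<in> \<Inter>(halfspaces P)"
    unfolding in_Inter_halfspaces x_def
  proof (clarify)
    fix b L assume bL: "(b, L) \<in> P"
    have "is_sectors L" using P bL by (auto simp: all_sectors_def)
    moreover have "real_vec (bump \<alpha> ?S \<epsilon>) \<in> halfspace b L" "real_vec \<beta> \<in> halfspace b L"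
      using y \<beta> bL by (auto simp: halfspaces_def)
    ultimately show "real_vec (\<chi> k. max (bump \<alpha> ?S \<epsilon> $ k) (c + \<beta> $ k)) \<in> halfspace b L"
      by (rule max_combination_in_halfspace)
  qed
  moreover have "real_vec x \<in> halfspace (abs_tproj \<alpha>) J" if "J \<in> \<J>" for J
    using \<beta>\<J>[OF that] px by (auto simp: real_vec_in_halfspace[OF \<J>[OF that]])
  ultimately have "real_vec x \<in> halfspace (abs_tproj \<beta>) K" using sub by blast
  \<comment> \<open>As \<open>?Z\<close> and \<open>?W\<close> are disjoint, this peak is
    \<open>?Z \<inter> ?S\<close>, which avoids \<open>K\<close> by the assumption on
    \<open>R\<close>.\<close>
  moreover have "peak (real_vec x) (abs_tproj \<beta>) = ?Z \<inter> (?S \<union> ?W)"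
    using peak_eq_inter[OF real_vec_in_space, of \<alpha> "abs_tproj \<beta>" x] ZS px by auto
  ultimately show False
    using R peak_disjoint[OF ne] by (auto simp: real_vec_in_halfspace[OF K])
qed

text \<open>\<open>Q\<close> is a second description of the same set, with apices in the set and
  different from \<alpha>. By \<open>tangent_closed_at_containing_halfspace\<close>, sets closed for
  \<open>P\<close> are closed for \<open>Q\<close>. So raising \<alpha> off \<open>R\<close> stays
  in the set, and the resulting peak \<open>- R\<close> must meet \<open>J\<close>.\<close>

lemma no_sectors_in_tangent_closed:
  assumes P: "all_sectors P" and finP: "finite (halfspaces P)"
    and Q: "all_sectors Q" and finQ: "finite (halfspaces Q)"
    and \<J>: "\<And>J. J \<in> \<J> \<Longrightarrow> is_sectors J"
    and eq: "\<Inter>(halfspaces Q) = \<Inter>(halfspaces P) \<inter> (\<Inter>J\<in>\<J>. halfspace (abs_tproj \<alpha>) J)"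
    and \<alpha>: "real_vec \<alpha> \<in> \<Inter>(halfspaces Q)"
    and apex: "\<And>b K. (b, K) \<in> Q \<Longrightarrow>
      b \<noteq> abs_tproj \<alpha> \<and> (\<exists>\<beta>. b = abs_tproj \<beta> \<and> real_vec \<beta> \<in> \<Inter>(halfspaces Q))"
    and cl: "tangent_closed \<alpha> P R" and R: "R \<noteq> UNIV"
    and J: "is_sectors J" "\<Inter>(halfspaces Q) \<subseteq> halfspace (abs_tproj \<alpha>) J"
  shows "\<not> J \<subseteq> R"
proof
  assume "J \<subseteq> R"
  have "tangent_closed \<alpha> Q R"
    unfolding tangent_closed_def
  proof (clarify)
    fix b K j assume bK: "(b, K) \<in> Q" and *: "peak (real_vec \<alpha>) b \<inter> K \<subseteq> R"
      and j: "j \<in> peak (real_vec \<alpha>) b"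
    obtain \<beta> where \<beta>: "b = abs_tproj \<beta>" "real_vec \<beta> \<in> \<Inter>(halfspaces Q)" "abs_tproj \<alpha> \<noteq> abs_tproj \<beta>"
      using apex[OF bK] by metis
    have K: "is_sectors K" using Q bK by (auto simp: all_sectors_def)
    have "\<Inter>(halfspaces Q) \<subseteq> halfspace b K"
      using bK by (auto simp: halfspaces_def)
    then have sub: "\<Inter>(halfspaces P) \<inter> (\<Inter>J\<in>\<J>. halfspace (abs_tproj \<alpha>) J) \<subseteq> halfspace (abs_tproj \<beta>) K"
      unfolding eq \<beta>(1) .
    have \<alpha>P: "real_vec \<alpha> \<in> \<Inter>(halfspaces P)" and \<beta>P: "real_vec \<beta> \<in> \<Inter>(halfspaces P)"
      and \<beta>J: "\<And>J. J \<in> \<J> \<Longrightarrow> real_vec \<beta> \<in> halfspace (abs_tproj \<alpha>) J"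
      using \<alpha> \<beta>(2) unfolding eq by blast+
    have "peak (real_vec \<alpha>) b \<subseteq> R"
      using tangent_closed_at_containing_halfspace[OF P finP \<alpha>P \<beta>P \<J> \<beta>J K sub \<beta>(3) cl] *
      unfolding \<beta>(1) by blast
    then show "j \<in> R" using j by blast
  qed
  then obtain \<epsilon> where \<epsilon>: "\<epsilon> > 0" and y: "real_vec (bump \<alpha> (- R) \<epsilon>) \<in> \<Inter>(halfspaces Q)"
    using bump_in_halfspaces[OF Q finQ \<alpha>, of "- R"] R by auto
  then have "peak (real_vec (bump \<alpha> (- R) \<epsilon>)) (abs_tproj \<alpha>) \<inter> J \<noteq> {}"
    using J(2) real_vec_in_halfspace[OF J(1)] by blast
  then show False using \<open>J \<subseteq> R\<close> peak_bump_self[OF \<epsilon>, of "- R"] R by auto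
qed

text \<open>A closed \<open>R\<close> that violates the right side gives a point violating the left,
  by raising \<alpha> off \<open>R\<close>. Conversely, for a point of the left-hand intersection
  the complement of its peak is closed, proper and contains no member of
  \<open>\<J>\<close>.\<close>

lemma Inter_halfspaces_subset_iff:
  assumes P: "all_sectors P" and fin: "finite (halfspaces P)"
    and \<alpha>: "real_vec \<alpha> \<in> \<Inter>(halfspaces P)"
    and \<J>: "\<And>J'. J' \<in> \<J> \<Longrightarrow> is_sectors J'" and J: "is_sectors J"
  shows "\<Inter>(halfspaces P) \<inter> (\<Inter>J'\<in>\<J>. halfspace (abs_tproj \<alpha>) J') \<subseteq> halfspace (abs_tproj \<alpha>) J \<longleftrightarrow>
    (\<forall>R. tangent_closed \<alpha> P R \<and> J \<subseteq> R \<longrightarrow> R = UNIV \<or> (\<exists>J'\<in>\<J>. J' \<subseteq> R))"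
    (is "?L \<longleftrightarrow> ?R")
proof
  assume L: ?L
  show ?R
  proof (intro allI impI, rule ccontr)
    fix R assume R: "tangent_closed \<alpha> P R \<and> J \<subseteq> R" and n: "\<not> (R = UNIV \<or> (\<exists>J'\<in>\<J>. J' \<subseteq> R))"
    have ne: "- R \<noteq> {}" using n by auto
    obtain \<epsilon> where \<epsilon>: "\<epsilon> > 0" and y: "real_vec (bump \<alpha> (- R) \<epsilon>) \<in> \<Inter>(halfspaces P)"
      using bump_in_halfspaces[OF P fin \<alpha>, of "- R"] R ne by auto
    have mem: "real_vec (bump \<alpha> (- R) \<epsilon>) \<in> halfspace (abs_tproj \<alpha>) J' \<longleftrightarrow> \<not> J' \<subseteq> R"
      if "is_sectors J'" for J'
      using peak_bump_self[OF \<epsilon> ne] by (auto simp: real_vec_in_halfspace[OF that])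
    have "real_vec (bump \<alpha> (- R) \<epsilon>) \<in> halfspace (abs_tproj \<alpha>) J'" if "J' \<in> \<J>" for J'
      using mem[OF \<J>[OF that]] n that by blast
    then have "real_vec (bump \<alpha> (- R) \<epsilon>) \<in> halfspace (abs_tproj \<alpha>) J"
      using y L by blast
    then show False using mem[OF J] R by blast
  qed
next
  assume R: ?R
  show ?L
  proof
    fix x assume x: "x \<in> \<Inter>(halfspaces P) \<inter> (\<Inter>J'\<in>\<J>. halfspace (abs_tproj \<alpha>) J')"
    show "x \<in> halfspace (abs_tproj \<alpha>) J"
    proof (cases "x \<in> maxplus_space - {maxplus_zero}")
      case True
      let ?R = "- peak x (abs_tproj \<alpha>)"
      have cl: "tangent_closed \<alpha> P ?R"
        using tangent_closed_Compl_peak[OF P _ True] x by blast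
      have "\<not> J' \<subseteq> ?R" if "J' \<in> \<J>" for J'
        using x that halfspace_eq_peak[OF \<J>[OF that]] by blast
      moreover have "?R \<noteq> UNIV" using peak_nonempty[of x "abs_tproj \<alpha>"] by auto
      ultimately have "\<not> J \<subseteq> ?R" using R cl by blast
      then show ?thesis using True by (auto simp: halfspace_eq_peak[OF J])
    next
      case False
      \<comment> \<open>The empty intersection is \<open>UNIV\<close>, so only an empty
        \<open>P\<close> admits such an \<open>x\<close>. Then \<open>J\<close> is itself closed and
        proper and contains some \<open>J'\<close>, whose half-space cannot contain
        \<open>x\<close>: the case is void.\<close>
      have "P = {}"
      proof (rule ccontr)
        assume "P \<noteq> {}"
        then obtain b K where "(b, K) \<in> P" by auto
        then have "is_sectors K" "x \<in> halfspace b K"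
          using P x by (auto simp: all_sectors_def halfspaces_def)
        then show False using False halfspace_eq_peak by blast
      qed
      then have "tangent_closed \<alpha> P J" by (simp add: tangent_closed_def)
      then obtain J' where "J' \<in> \<J>" using R J by (auto simp: is_sectors_def)
      then show ?thesis using x False halfspace_eq_peak[OF \<J>] by blast
    qed
  qed
qed

subsection \<open>Boundary-generating sets of apices\<close>

lemma real_vec_in_halfspace_cong:
  assumes "is_sectors K" "abs_tproj x = abs_tproj y"
  shows "real_vec x \<in> halfspace b K \<longleftrightarrow> real_vec y \<in> halfspace b K"
proof -
  obtain \<beta> where b: "b = abs_tproj \<beta>" by (rule tproj_rep)
  obtain c where "\<And>i. x $ i = c + y $ i"
    using assms(2) by (auto simp: tproj.abs_eq_iff proj_rel_def)
  then show ?thesis by (simp add: b real_vec_in_halfspace_abs[OF assms(1)] algebra_simps)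
qed

lemma closed_real_vec_in_halfspace:
  assumes "is_sectors K"
  shows "closed {x. real_vec x \<in> halfspace b K}"
proof -
  obtain \<beta> where b: "b = abs_tproj \<beta>" by (rule tproj_rep)
  have "{x. real_vec x \<in> halfspace b K} = (\<Union>i\<in>K. \<Inter>k. {x. x $ k - \<beta> $ k \<le> x $ i - \<beta> $ i})"
    by (auto simp: b real_vec_in_halfspace_abs[OF assms])
  also have "closed \<dots>"
    by (intro closed_UN closed_INT closed_Collect_le continuous_intros ballI) auto
  finally show ?thesis .
qed

definition apex_pairs ::
    "(ereal ^ 'n::finite) set \<Rightarrow> 'n tproj set \<Rightarrow> ('n tproj \<times> 'n set) set" where
  "apex_pairs C X = {(b, K). b \<in> X \<and> is_sectors K \<and> C - {maxplus_zero} \<subseteq> halfspace b K}"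

lemma all_sectors_apex_pairs: "all_sectors (apex_pairs C X)"
  by (auto simp: all_sectors_def apex_pairs_def)

lemma halfspaces_apex_pairs: "halfspaces (apex_pairs C X) = (\<Union>c\<in>X. Sigma_at C c)"
  by (force simp: halfspaces_def apex_pairs_def Sigma_at_def)

lemma finite_halfspaces_apex_pairs:
  assumes "finite X"
  shows "finite (halfspaces (apex_pairs C X))"
proof -
  have "apex_pairs C X \<subseteq> X \<times> UNIV" by (auto simp: apex_pairs_def)
  then show ?thesis
    unfolding halfspaces_def using assms by (metis finite_SigmaI finite finite_imageI finite_subset)
qed

lemma subset_Inter_apex_pairs: "C - {maxplus_zero} \<subseteq> \<Inter>(halfspaces (apex_pairs C X))"
  by (auto simp: halfspaces_def apex_pairs_def)

lemma tau_eq_Sigma_all_iff: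
  assumes "\<Inter>\<Gamma>\<^sub>0 = C - {maxplus_zero}" "\<Gamma>\<^sub>0 \<subseteq> Sigma_all C"
  shows "tau C \<Gamma> = Sigma_all C \<longleftrightarrow> \<Inter>\<Gamma> \<subseteq> C - {maxplus_zero}"
proof
  assume "tau C \<Gamma> = Sigma_all C"
  then have "\<Inter>\<Gamma> \<subseteq> H" if "H \<in> \<Gamma>\<^sub>0" for H using that assms(2) by (auto simp: tau_def)
  then show "\<Inter>\<Gamma> \<subseteq> C - {maxplus_zero}" unfolding assms(1)[symmetric] by blast
next
  assume "\<Inter>\<Gamma> \<subseteq> C - {maxplus_zero}"
  moreover have "C - {maxplus_zero} \<subseteq> H" if "H \<in> Sigma_all C" for H
    using that by (auto simp: Sigma_all_def)
  ultimately show "tau C \<Gamma> = Sigma_all C" unfolding tau_def by blast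
qed

text \<open>An external description of the cone. That the apices lie in the cone is left to an
  extension, because for a boundary point this follows from the closedness proved here.\<close>

locale represented_cone =
  fixes C :: "(ereal ^ 'n::finite) set" and P :: "('n tproj \<times> 'n set) set"
  assumes sectors_P: "all_sectors P"
    and cone_eq: "C - {maxplus_zero} = \<Inter>(halfspaces P)"
begin

lemma abs_in_proj_image_iff: "abs_tproj x \<in> proj_image C \<longleftrightarrow> real_vec x \<in> C - {maxplus_zero}"
proof
  assume "abs_tproj x \<in> proj_image C"
  then obtain y where y: "abs_tproj x = abs_tproj y" "real_vec y \<in> C"
    by (auto simp: proj_image_def)
  then have "real_vec y \<in> \<Inter>(halfspaces P)"
    using cone_eq real_vec_in_space by blast
  then show "real_vec x \<in> C - {maxplus_zero}"
    using sectors_P real_vec_in_halfspace_cong[OF _ y(1)]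
    unfolding cone_eq in_Inter_halfspaces all_sectors_def by blast
next
  assume "real_vec x \<in> C - {maxplus_zero}"
  then show "abs_tproj x \<in> proj_image C" by (auto simp: proj_image_def)
qed

lemma closed_proj_image: "closed (proj_image C)"
proof -
  have "abs_tproj -` (- proj_image C) = - (\<Inter>(b, K)\<in>P. {x. real_vec x \<in> halfspace b K})"
    using abs_in_proj_image_iff unfolding cone_eq in_Inter_halfspaces by auto
  moreover have "closed (\<Inter>(b, K)\<in>P. {x. real_vec x \<in> halfspace b K})"
    using sectors_P
    by (intro closed_INT) (auto simp: all_sectors_def intro!: closed_real_vec_in_halfspace)
  ultimately show ?thesis by (simp add: closed_def open_tproj_def)
qed

lemma cone_boundary_subset: "cone_boundary C \<subseteq> proj_image C"
  using closed_proj_image by (simp add: cone_boundary_def frontier_subset_closed)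

text \<open>Raising the apex off \<open>K\<close> by a positive \<epsilon> gives the peak
  \<open>- K\<close>, so points arbitrarily near the apex leave the half-space and with it the
  cone.\<close>

lemma apex_in_cone_boundary:
  assumes b: "b \<in> proj_image C" and K: "is_sectors K" and sub: "C - {maxplus_zero} \<subseteq> halfspace b K"
  shows "b \<in> cone_boundary C"
proof -
  obtain \<beta> where \<beta>: "b = abs_tproj \<beta>" by (rule tproj_rep)
  have "b \<notin> interior (proj_image C)"
  proof
    assume "b \<in> interior (proj_image C)"
    then obtain U where U: "open U" "b \<in> U" "U \<subseteq> proj_image C" by (auto simp: interior_def)
    then have "open (abs_tproj -` U)" "\<beta> \<in> abs_tproj -` U" by (auto simp: open_tproj_def \<beta>)
    moreover have "((\<lambda>\<epsilon>. bump \<beta> (- K) \<epsilon>) \<longlongrightarrow> bump \<beta> (- K) 0) (at_right 0)"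
      unfolding bump_def by (rule tendsto_vec_lambda) (auto intro!: tendsto_eq_intros)
    moreover have "bump \<beta> (- K) 0 = \<beta>" by (simp add: bump_def vec_eq_iff)
    ultimately have "\<forall>\<^sub>F \<epsilon> in at_right 0. bump \<beta> (- K) \<epsilon> \<in> abs_tproj -` U"
      by (metis topological_tendstoD)
    moreover have "\<forall>\<^sub>F \<epsilon>::real in at_right 0. \<epsilon> > 0" by (rule eventually_at_right_less)
    ultimately have "\<forall>\<^sub>F \<epsilon> in at_right 0. \<epsilon> > 0 \<and> bump \<beta> (- K) \<epsilon> \<in> abs_tproj -` U"
      by eventually_elim simp
    then obtain \<epsilon> where \<epsilon>: "\<epsilon> > 0" "abs_tproj (bump \<beta> (- K) \<epsilon>) \<in> U"
      using eventually_happens' trivial_limit_at_right_real by blast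
    then have "real_vec (bump \<beta> (- K) \<epsilon>) \<in> halfspace b K"
      using U sub abs_in_proj_image_iff by blast
    moreover have "peak (real_vec (bump \<beta> (- K) \<epsilon>)) b = - K"
      unfolding \<beta> using peak_bump_self[OF \<epsilon>(1), of "- K"] K by (auto simp: is_sectors_def)
    ultimately show False by (simp add: real_vec_in_halfspace[OF K])
  qed
  then show ?thesis
    using b closure_subset by (auto simp: cone_boundary_def frontier_def)
qed

end

locale apex_represented_cone = represented_cone +
  assumes finite_P: "finite P"
    and apex_P: "(b, K) \<in> P \<Longrightarrow> b \<in> proj_image C"
begin

text \<open>Apices of \<open>P\<close> are boundary points, so a generating \<open>X\<close> implies
  every half-space of \<open>P\<close>. Conversely, half-spaces that contain the cone and have a
  boundary apex lie in \<open>Sigma_all C\<close>, as the boundary belongs to the closed image of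
  the cone.\<close>

lemma generates_boundary_iff:
  "generates_boundary C X \<longleftrightarrow>
     finite X \<and> X \<subseteq> cone_boundary C \<and> \<Inter>(halfspaces (apex_pairs C X)) = C - {maxplus_zero}"
proof -
  let ?D = "\<Inter>(halfspaces (apex_pairs C X))"
  have "tau' C X = cone_boundary C \<longleftrightarrow> ?D \<subseteq> C - {maxplus_zero}"
  proof
    assume *: "tau' C X = cone_boundary C"
    have "?D \<subseteq> halfspace b K" if bK: "(b, K) \<in> P" for b K
    proof -
      have K: "is_sectors K" using bK sectors_P by (auto simp: all_sectors_def)
      have sub: "C - {maxplus_zero} \<subseteq> halfspace b K"
        unfolding cone_eq using bK by (auto simp: halfspaces_def)
      have "b \<in> tau' C X" using * apex_in_cone_boundary[OF apex_P[OF bK] K sub] by simp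
      moreover have "halfspace b K \<in> Sigma_at C b" using K sub by (auto simp: Sigma_at_def)
      ultimately show ?thesis by (auto simp: tau'_def tau_def halfspaces_apex_pairs)
    qed
    then show "?D \<subseteq> C - {maxplus_zero}" unfolding cone_eq by (auto simp: halfspaces_def[of P])
  next
    assume *: "?D \<subseteq> C - {maxplus_zero}"
    have "Sigma_at C b \<subseteq> tau C (\<Union>c\<in>X. Sigma_at C c)" if "b \<in> cone_boundary C" for b
    proof
      fix H assume "H \<in> Sigma_at C b"
      then obtain K where K: "H = halfspace b K" "is_sectors K" "C - {maxplus_zero} \<subseteq> halfspace b K"
        by (auto simp: Sigma_at_def)
      then have "H \<in> Sigma_all C"
        using that cone_boundary_subset by (auto simp: Sigma_all_def)
      moreover have "?D \<subseteq> H" using * K by blast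
      ultimately show "H \<in> tau C (\<Union>c\<in>X. Sigma_at C c)"
        by (simp add: tau_def halfspaces_apex_pairs)
    qed
    then show "tau' C X = cone_boundary C" by (auto simp: tau'_def)
  qed
  then show ?thesis
    using subset_Inter_apex_pairs[of C X] by (auto simp: generates_boundary_def)
qed

text \<open>Adding to \<open>Q\<close> all other half-spaces with the same apices that contain the
  cone leaves the intersection unchanged.\<close>

lemma generates_boundary_apices:
  assumes "finite Q" "all_sectors Q" "\<Inter>(halfspaces Q) = C - {maxplus_zero}"
    and "\<And>b K. (b, K) \<in> Q \<Longrightarrow> b \<in> proj_image C"
  shows "generates_boundary C (fst ` Q)"
proof -
  have Q: "is_sectors K" "C - {maxplus_zero} \<subseteq> halfspace b K" if "(b, K) \<in> Q" for b K
    using assms(2,3) that by (auto simp: all_sectors_def halfspaces_def)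
  then have "Q \<subseteq> apex_pairs C (fst ` Q)" by (force simp: apex_pairs_def)
  then have "\<Inter>(halfspaces (apex_pairs C (fst ` Q))) \<subseteq> C - {maxplus_zero}"
    unfolding assms(3)[symmetric] halfspaces_def by blast
  moreover have "fst ` Q \<subseteq> cone_boundary C"
  proof
    fix b assume "b \<in> fst ` Q"
    then obtain K where bK: "(b, K) \<in> Q" by auto
    show "b \<in> cone_boundary C"
      using apex_in_cone_boundary[OF assms(4)[OF bK] Q[OF bK]] .
  qed
  ultimately show ?thesis
    unfolding generates_boundary_iff
    using assms(1) subset_Inter_apex_pairs[of C "fst ` Q"] by blast
qed

lemma no_sectors_in_tangent_closed_generating:
  assumes Y: "generates_boundary C Y" and a: "abs_tproj \<alpha> \<in> cone_boundary C" "abs_tproj \<alpha> \<notin> Y"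
    and Q: "all_sectors Q" "finite (halfspaces Q)"
    and \<J>: "\<And>J. J \<in> \<J> \<Longrightarrow> is_sectors J"
    and eq: "C - {maxplus_zero} = \<Inter>(halfspaces Q) \<inter> (\<Inter>J\<in>\<J>. halfspace (abs_tproj \<alpha>) J)"
    and cl: "tangent_closed \<alpha> Q R" "R \<noteq> UNIV"
    and J: "is_sectors J" "C - {maxplus_zero} \<subseteq> halfspace (abs_tproj \<alpha>) J"
  shows "\<not> J \<subseteq> R"
proof (rule no_sectors_in_tangent_closed[OF Q all_sectors_apex_pairs finite_halfspaces_apex_pairs \<J>])
  have YC: "\<Inter>(halfspaces (apex_pairs C Y)) = C - {maxplus_zero}" "finite Y" "Y \<subseteq> cone_boundary C"
    using Y by (auto simp: generates_boundary_iff)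
  show "finite Y" by fact
  show "\<Inter>(halfspaces (apex_pairs C Y)) = \<Inter>(halfspaces Q) \<inter> (\<Inter>J\<in>\<J>. halfspace (abs_tproj \<alpha>) J)"
    unfolding YC(1) by (rule eq)
  show "real_vec \<alpha> \<in> \<Inter>(halfspaces (apex_pairs C Y))"
    unfolding YC(1) using a(1) cone_boundary_subset abs_in_proj_image_iff by blast
  show "\<Inter>(halfspaces (apex_pairs C Y)) \<subseteq> halfspace (abs_tproj \<alpha>) J"
    unfolding YC(1) by (rule J(2))
  show "b \<noteq> abs_tproj \<alpha> \<and> (\<exists>\<beta>. b = abs_tproj \<beta> \<and> real_vec \<beta> \<in> \<Inter>(halfspaces (apex_pairs C Y)))"
    if "(b, K) \<in> apex_pairs C Y" for b K
  proof -
    have b: "b \<in> Y" using that by (auto simp: apex_pairs_def)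
    obtain \<beta> where \<beta>: "b = abs_tproj \<beta>" by (rule tproj_rep)
    have "real_vec \<beta> \<in> C - {maxplus_zero}"
      using b YC(3) cone_boundary_subset abs_in_proj_image_iff unfolding \<beta> by blast
    then show ?thesis using b a(2) \<beta> unfolding YC(1) by blast
  qed
qed (use cl J in auto)

text \<open>The other half-spaces have to imply those with apex \<open>a\<close>. Since
  \<open>Y\<close> avoids \<open>a\<close>, every closed set containing the sectors \<open>J\<close>
  of such a half-space is \<open>UNIV\<close>; by \<open>Inter_halfspaces_subset_iff\<close> with an
  empty family this is the required implication.\<close>

lemma generates_boundary_exchange:
  assumes X: "generates_boundary C X" and Y: "generates_boundary C Y"
    and a: "a \<in> X" "a \<notin> Y"
  shows "generates_boundary C (X - {a})"
proof -
  obtain \<alpha> where \<alpha>: "a = abs_tproj \<alpha>" by (rule tproj_rep)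
  have XC: "\<Inter>(halfspaces (apex_pairs C X)) = C - {maxplus_zero}" "finite X" "X \<subseteq> cone_boundary C"
    using X by (auto simp: generates_boundary_iff)
  define \<J> where "\<J> = {J. is_sectors J \<and> C - {maxplus_zero} \<subseteq> halfspace a J}"
  let ?Q = "apex_pairs C (X - {a})"
  have Q: "all_sectors ?Q" "finite (halfspaces ?Q)" "C - {maxplus_zero} \<subseteq> \<Inter>(halfspaces ?Q)"
    using all_sectors_apex_pairs finite_halfspaces_apex_pairs XC(2) subset_Inter_apex_pairs
    by (blast, blast, blast)
  have "apex_pairs C X \<subseteq> ?Q \<union> {a} \<times> \<J>" by (auto simp: apex_pairs_def \<J>_def)
  then have "\<Inter>(halfspaces ?Q) \<inter> (\<Inter>J\<in>\<J>. halfspace a J) \<subseteq> C - {maxplus_zero}"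
    unfolding XC(1)[symmetric] halfspaces_def by blast
  then have eq: "C - {maxplus_zero} = \<Inter>(halfspaces ?Q) \<inter> (\<Inter>J\<in>\<J>. halfspace a J)"
    using Q(3) by (auto simp: \<J>_def)
  have ab: "abs_tproj \<alpha> \<in> cone_boundary C" using a XC(3) by (auto simp: \<alpha>)
  have "\<Inter>(halfspaces ?Q) \<subseteq> halfspace a J" if J: "J \<in> \<J>" for J
  proof -
    have "real_vec \<alpha> \<in> \<Inter>(halfspaces ?Q)"
      using Q(3) ab cone_boundary_subset abs_in_proj_image_iff by blast
    moreover have "R = UNIV" if "tangent_closed \<alpha> ?Q R" "J \<subseteq> R" for R
      using no_sectors_in_tangent_closed_generating[OF Y ab _ Q(1,2), of \<J> R J] that J eq a(2)
      unfolding \<alpha> \<J>_def by blast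
    ultimately show ?thesis
      using Inter_halfspaces_subset_iff[OF Q(1,2), of \<alpha> "{}" J] J unfolding \<alpha> \<J>_def by blast
  qed
  then have "\<Inter>(halfspaces ?Q) = C - {maxplus_zero}" using eq by blast
  then show ?thesis using XC by (auto simp: generates_boundary_iff)
qed

text \<open>By exchange, a minimal generating set lies in every generating set. So it equals their
  intersection and is unique; one of least cardinality shows existence.\<close>

lemma nonredundant_apices_eq: "nonredundant_apices C = \<Inter>{X. generates_boundary C X}"
proof -
  let ?G = "generates_boundary C"
  let ?min = "\<lambda>X. ?G X \<and> (\<forall>Y. ?G Y \<and> Y \<subseteq> X \<longrightarrow> Y = X)"
  have eq: "X = \<Inter>{X. ?G X}" if "?min X" for X
  proof -
    have "a \<in> Y" if "a \<in> X" "?G Y" for a Y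
      using generates_boundary_exchange[of X Y a] \<open>?min X\<close> that by blast
    then show ?thesis using that by blast
  qed
  have "?G (fst ` P)"
    using generates_boundary_apices[of P] finite_P sectors_P apex_P cone_eq by simp
  then obtain X where X: "?G X" "\<And>Y. ?G Y \<Longrightarrow> card X \<le> card Y"
    using ex_has_least_nat[of ?G _ card] by blast
  have "?min X"
    using X by (metis card_seteq generates_boundary_iff)
  then have "(THE X. ?min X) = X"
    by (rule the_equality) (metis eq \<open>?min X\<close>)
  then show ?thesis
    unfolding nonredundant_apices_def using eq[OF \<open>?min X\<close>] by argo
qed

end

subsection \<open>Reachability in the tangent hypergraph\<close>

lemma active_at_iff:
  assumes "is_sectors K"
  shows "active_at (abs_tproj \<alpha>) b K \<longleftrightarrow>
    peak (real_vec \<alpha>) b \<inter> K \<noteq> {} \<and> peak (real_vec \<alpha>) b - K \<noteq> {}"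
proof -
  obtain \<beta> where b: "b = abs_tproj \<beta>" by (rule tproj_rep)
  have "K \<noteq> {}" "- K \<noteq> {}" using assms by (auto simp: is_sectors_def)
  then show ?thesis
    using max_diff_Compl_le_iff[of K "real_vec \<alpha>" \<beta>] max_diff_Compl_le_iff[of "- K" "real_vec \<alpha>" \<beta>]
    by (auto simp: b active_at.abs_eq Diff_eq)
qed

lemma argmax_diff_eq_peak:
  assumes "peak (real_vec \<alpha>) b \<inter> K \<noteq> {}"
  shows "argmax_diff (abs_tproj \<alpha>) b K = peak (real_vec \<alpha>) b \<inter> K"
proof -
  obtain \<beta> where b: "b = abs_tproj \<beta>" by (rule tproj_rep)
  obtain j where "j \<in> K" "\<And>k. \<alpha> $ k - \<beta> $ k \<le> \<alpha> $ j - \<beta> $ j"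
    using assms by (auto simp: b peak_real_vec)
  then show ?thesis
    by (auto simp: b peak_real_vec argmax_diff.abs_eq is_arg_max_linorder) (meson order_trans)
qed

text \<open>All presentations are kept, as in the tangent hypergraph; the set of half-spaces they
  present is still finite when \<Lambda> is.\<close>

definition presentations :: "(ereal ^ 'n::finite) set set \<Rightarrow> ('n tproj \<times> 'n set) set" where
  "presentations \<Lambda> = {(b, K). is_sectors K \<and> halfspace b K \<in> \<Lambda>}"

lemma tangent_hypergraph_eq:
  "tangent_hypergraph \<Lambda> (abs_tproj \<alpha>) =
     (\<lambda>(b, K). (peak (real_vec \<alpha>) b \<inter> K, peak (real_vec \<alpha>) b - K)) `
       {(b, K) \<in> presentations \<Lambda>. active_at (abs_tproj \<alpha>) b K}"
proof -
  have "(argmax_diff (abs_tproj \<alpha>) b K, argmax_diff (abs_tproj \<alpha>) b (- K)) =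
      (peak (real_vec \<alpha>) b \<inter> K, peak (real_vec \<alpha>) b - K)"
    if "is_sectors K" "active_at (abs_tproj \<alpha>) b K" for b K
    using that(2) argmax_diff_eq_peak[of \<alpha> b K] argmax_diff_eq_peak[of \<alpha> b "- K"]
    unfolding active_at_iff[OF that(1)] by (simp add: Diff_eq)
  then have "tangent_hypergraph \<Lambda> (abs_tproj \<alpha>) =
      {(peak (real_vec \<alpha>) b \<inter> K, peak (real_vec \<alpha>) b - K) |b K.
        is_sectors K \<and> halfspace b K \<in> \<Lambda> \<and> active_at (abs_tproj \<alpha>) b K}"
    unfolding tangent_hypergraph_def by (metis (no_types, lifting))
  then show ?thesis by (auto simp: presentations_def)
qed

lemma all_sectors_presentations: "all_sectors (presentations \<Lambda>)"
  by (auto simp: all_sectors_def presentations_def)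

lemma halfspaces_presentations:
  assumes "\<Lambda> \<subseteq> Sigma_all C"
  shows "halfspaces (presentations \<Lambda>) = \<Lambda>"
  using assms by (fastforce simp: halfspaces_def presentations_def Sigma_all_def)

text \<open>As \<alpha> lies in all the half-spaces, each peak meets its \<open>K\<close>. For an
  inactive pair the peak lies within \<open>K\<close>, and the closedness condition holds
  trivially.\<close>

lemma tangent_closed_presentations_iff:
  assumes "real_vec \<alpha> \<in> \<Inter>\<Lambda>"
  shows "tangent_closed \<alpha> (presentations \<Lambda>) R \<longleftrightarrow>
    (\<forall>(T, H)\<in>tangent_hypergraph \<Lambda> (abs_tproj \<alpha>). T \<subseteq> R \<longrightarrow> H \<subseteq> R)"
proof -
  have *: "(peak (real_vec \<alpha>) b \<inter> K \<subseteq> R \<longrightarrow> peak (real_vec \<alpha>) b \<subseteq> R) \<longleftrightarrow>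
      (active_at (abs_tproj \<alpha>) b K \<longrightarrow> peak (real_vec \<alpha>) b \<inter> K \<subseteq> R \<longrightarrow> peak (real_vec \<alpha>) b - K \<subseteq> R)"
    if "(b, K) \<in> presentations \<Lambda>" for b K
  proof -
    have K: "is_sectors K" and "real_vec \<alpha> \<in> halfspace b K"
      using that assms by (auto simp: presentations_def)
    then show ?thesis
      unfolding active_at_iff[OF K] real_vec_in_halfspace[OF K] by blast
  qed
  have "tangent_closed \<alpha> (presentations \<Lambda>) R \<longleftrightarrow> (\<forall>(b, K)\<in>presentations \<Lambda>.
      active_at (abs_tproj \<alpha>) b K \<longrightarrow> peak (real_vec \<alpha>) b \<inter> K \<subseteq> R \<longrightarrow> peak (real_vec \<alpha>) b - K \<subseteq> R)"
    unfolding tangent_closed_def using * by (intro ball_cong) auto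
  also have "\<dots> \<longleftrightarrow> (\<forall>(T, H)\<in>tangent_hypergraph \<Lambda> (abs_tproj \<alpha>). T \<subseteq> R \<longrightarrow> H \<subseteq> R)"
    unfolding tangent_hypergraph_eq by auto
  finally show ?thesis .
qed

lemma subset_hyper_reach: "I \<subseteq> hyper_reach G I"
  by (auto intro: hyper_reach.intros)

lemma hyper_reach_closed: "(T, H) \<in> G \<Longrightarrow> T \<subseteq> hyper_reach G I \<Longrightarrow> H \<subseteq> hyper_reach G I"
  by (auto intro: hyper_reach.intros(2))

lemma hyper_reach_least:
  assumes "I \<subseteq> R" "\<forall>(T, H)\<in>G. T \<subseteq> R \<longrightarrow> H \<subseteq> R"
  shows "hyper_reach G I \<subseteq> R"
proof
  fix j assume "j \<in> hyper_reach G I"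
  then show "j \<in> R" by induction (use assms in blast)+
qed

lemma hyper_reach_mono: "I \<subseteq> hyper_reach G J \<Longrightarrow> hyper_reach G I \<subseteq> hyper_reach G J"
  by (rule hyper_reach_least) (auto dest: hyper_reach_closed)

text \<open>The condition on \<open>R\<close> in \<open>Inter_halfspaces_subset_iff\<close> is
  monotone, so it need only be tested on the least closed set containing \<open>J\<close>, which is
  \<open>hyper_reach\<close>.\<close>

lemma Inter_subset_halfspace_iff_hyper_reach:
  assumes \<Lambda>: "finite \<Lambda>" "\<Lambda> \<subseteq> Sigma_all C" and \<alpha>: "real_vec \<alpha> \<in> \<Inter>\<Lambda>"
    and \<J>: "\<And>J'. J' \<in> \<J> \<Longrightarrow> is_sectors J'" and J: "is_sectors J"
  shows "\<Inter>\<Lambda> \<inter> (\<Inter>J'\<in>\<J>. halfspace (abs_tproj \<alpha>) J') \<subseteq> halfspace (abs_tproj \<alpha>) J \<longleftrightarrow>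
    hyper_reach (tangent_hypergraph \<Lambda> (abs_tproj \<alpha>)) J = UNIV \<or>
    (\<exists>J'\<in>\<J>. J' \<subseteq> hyper_reach (tangent_hypergraph \<Lambda> (abs_tproj \<alpha>)) J)"
proof -
  let ?G = "tangent_hypergraph \<Lambda> (abs_tproj \<alpha>)"
  have cl: "\<forall>(T, H)\<in>?G. T \<subseteq> hyper_reach ?G J \<longrightarrow> H \<subseteq> hyper_reach ?G J"
    using hyper_reach_closed by blast
  have *: "(\<forall>R. (\<forall>(T, H)\<in>?G. T \<subseteq> R \<longrightarrow> H \<subseteq> R) \<and> J \<subseteq> R \<longrightarrow> R = UNIV \<or> (\<exists>J'\<in>\<J>. J' \<subseteq> R)) \<longleftrightarrow>
      hyper_reach ?G J = UNIV \<or> (\<exists>J'\<in>\<J>. J' \<subseteq> hyper_reach ?G J)" (is "?L \<longleftrightarrow> ?R")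
  proof
    assume ?L
    then show ?R using cl subset_hyper_reach[of J ?G] by blast
  next
    assume r: ?R
    show ?L
    proof (intro allI impI)
      fix R assume "(\<forall>(T, H)\<in>?G. T \<subseteq> R \<longrightarrow> H \<subseteq> R) \<and> J \<subseteq> R"
      then have "hyper_reach ?G J \<subseteq> R" by (intro hyper_reach_least) auto
      then show "R = UNIV \<or> (\<exists>J'\<in>\<J>. J' \<subseteq> R)" using r by blast
    qed
  qed
  have eq: "halfspaces (presentations \<Lambda>) = \<Lambda>" by (rule halfspaces_presentations[OF \<Lambda>(2)])
  show ?thesis
    using Inter_halfspaces_subset_iff[OF all_sectors_presentations[of \<Lambda>], of \<alpha> \<J> J,
        unfolded eq, OF \<Lambda>(1) \<alpha> \<J> J]
    unfolding tangent_closed_presentations_iff[OF \<alpha>] * by blast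
qed

text \<open>\<open>hyper_reach\<close> is a closure operator, so the arc relation is already
  reflexive and transitive, and paths collapse to single arcs.\<close>

lemma reachable_reach_digraph_iff:
  "reachable (reach_digraph C \<Lambda> a) I J \<longleftrightarrow>
     I \<in> reach_nodes C a \<and> J \<in> reach_nodes C a \<and> J \<subseteq> hyper_reach (tangent_hypergraph \<Lambda> a) I"
proof
  let ?r = "hyper_reach (tangent_hypergraph \<Lambda> a)"
  assume "reachable (reach_digraph C \<Lambda> a) I J"
  then have "(I, J) \<in> rtrancl_on (verts (reach_digraph C \<Lambda> a)) (arcs_ends (reach_digraph C \<Lambda> a))"
    by (simp add: reachable_def)
  then show "I \<in> reach_nodes C a \<and> J \<in> reach_nodes C a \<and> J \<subseteq> ?r I"
  proof (induction rule: rtrancl_on_induct)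
    case base
    then show ?case by (simp add: reach_digraph_def subset_hyper_reach)
  next
    case (step J J')
    then have "J' \<subseteq> ?r J" "J' \<in> reach_nodes C a"
      by (auto simp: reach_digraph_def arcs_ends_def arc_to_ends_def)
    then show ?case using step.IH hyper_reach_mono by blast
  qed
next
  assume "I \<in> reach_nodes C a \<and> J \<in> reach_nodes C a \<and> J \<subseteq> hyper_reach (tangent_hypergraph \<Lambda> a) I"
  then show "reachable (reach_digraph C \<Lambda> a) I J"
    unfolding reachable_def
    by (intro rtrancl_on_into_rtrancl_on[OF rtrancl_on_refl])
      (auto simp: reach_digraph_def arcs_ends_def arc_to_ends_def)
qed

subsection \<open>Maximal strongly connected components\<close>

lemma reachable_compose: "reachable G u v \<Longrightarrow> reachable G v w \<Longrightarrow> reachable G u w"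
  unfolding reachable_def by (rule rtrancl_on_trans)

lemma scc_of_vertex:
  assumes "v \<in> verts G"
  shows "{w. reachable G v w \<and> reachable G w v} \<in> pre_digraph.sccs_verts G"
proof -
  have "reachable G v v" using assms by (simp add: reachable_def)
  then show ?thesis
    unfolding pre_digraph.sccs_verts_def using reachable_compose[of G] by blast
qed

lemma sccs_verts_eq:
  assumes "S \<in> pre_digraph.sccs_verts G" "v \<in> S"
  shows "S = {w. reachable G v w \<and> reachable G w v}"
  using assms unfolding pre_digraph.sccs_verts_def by blast

text \<open>Among the vertices reachable from \<open>v\<close>, take one that reaches the fewest
  vertices. Whatever it reaches has the same set of reachable vertices and hence leads back to
  it.\<close>

lemma maximal_scc_above:
  assumes fin: "finite (verts G)" and v: "v \<in> verts G"
  obtains S w where "S \<in> maximal_sccs G" "w \<in> S" "reachable G v w"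
proof -
  let ?up = "\<lambda>w. {x. reachable G w x}"
  have vv: "reachable G v v" using v by (simp add: reachable_def)
  have finup: "finite (?up w)" for w
    by (rule finite_subset[OF _ fin]) (auto simp: reachable_def dest: in_rtrancl_on_in_F)
  obtain w where w: "reachable G v w" "\<And>x. reachable G v x \<Longrightarrow> card (?up w) \<le> card (?up x)"
    using ex_has_least_nat[of "reachable G v" v "\<lambda>w. card (?up w)"] vv by blast
  have ww: "w \<in> verts G" using w(1) by (auto simp: reachable_def dest: in_rtrancl_on_in_F)
  then have wr: "reachable G w w" by (simp add: reachable_def)
  let ?S = "{x. reachable G w x \<and> reachable G x w}"
  have "?S \<in> maximal_sccs G"
    unfolding maximal_sccs_def
  proof (intro CollectI conjI ballI impI scc_of_vertex ww)
    fix S' assume S': "S' \<in> pre_digraph.sccs_verts G" and "scc_le G ?S S'"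
    then obtain x where x: "x \<in> S'" "reachable G w x"
      unfolding scc_le_def using reachable_compose[of G] by blast
    have "?up x \<subseteq> ?up w" using x reachable_compose[of G] by blast
    moreover have "card (?up w) \<le> card (?up x)"
      using w x reachable_compose[of G] by blast
    ultimately have "?up x = ?up w" using card_seteq[OF finup] by blast
    then have "reachable G x w" using wr by blast
    then show "S' = ?S"
      unfolding sccs_verts_eq[OF S' x(1)] using x(2) reachable_compose[of G] by blast
  qed
  then show thesis using that w(1) wr by blast
qed

text \<open>A maximal component absorbs everything its vertices reach. Conversely every vertex
  reaches a maximal component, inside which all vertices are mutually reachable.\<close>

lemma cofinal_iff_meets_maximal_sccs:
  assumes fin: "finite (verts G)" and I: "\<And>l. l \<in> L \<Longrightarrow> I l \<in> verts G"
  shows "(\<forall>v\<in>verts G. \<exists>l\<in>L. reachable G v (I l)) \<longleftrightarrow> (\<forall>S\<in>maximal_sccs G. \<exists>l\<in>L. I l \<in> S)"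
proof
  assume *: "\<forall>v\<in>verts G. \<exists>l\<in>L. reachable G v (I l)"
  show "\<forall>S\<in>maximal_sccs G. \<exists>l\<in>L. I l \<in> S"
  proof
    fix S assume S: "S \<in> maximal_sccs G"
    then obtain v where v: "v \<in> S" "reachable G v v"
      unfolding maximal_sccs_def pre_digraph.sccs_verts_def by blast
    then have "v \<in> verts G" by (auto simp: reachable_def dest: in_rtrancl_on_in_F)
    then obtain l where l: "l \<in> L" "reachable G v (I l)" using * by blast
    let ?S = "{w. reachable G (I l) w \<and> reachable G w (I l)}"
    have "I l \<in> ?S" using I[OF l(1)] by (simp add: reachable_def)
    moreover have "?S = S"
    proof -
      have "scc_le G S ?S" unfolding scc_le_def using v(1) l(2) \<open>I l \<in> ?S\<close> by blast
      then show ?thesis using S scc_of_vertex[OF I[OF l(1)]] by (simp add: maximal_sccs_def)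
    qed
    ultimately show "\<exists>l\<in>L. I l \<in> S" using l(1) by blast
  qed
next
  assume *: "\<forall>S\<in>maximal_sccs G. \<exists>l\<in>L. I l \<in> S"
  show "\<forall>v\<in>verts G. \<exists>l\<in>L. reachable G v (I l)"
  proof
    fix v assume "v \<in> verts G"
    then obtain S w where w: "S \<in> maximal_sccs G" "w \<in> S" "reachable G v w"
      using maximal_scc_above[OF fin] by blast
    then obtain l where "l \<in> L" "I l \<in> S" using * by blast
    moreover have "reachable G w (I l)"
      using w \<open>I l \<in> S\<close> unfolding maximal_sccs_def pre_digraph.sccs_verts_def by blast
    ultimately show "\<exists>l\<in>L. reachable G v (I l)"
      using w(3) reachable_compose by fast
  qed
qed

lemma maximal_sccs_disjoint:
  assumes "S \<in> maximal_sccs G" "T \<in> maximal_sccs G" "x \<in> S" "x \<in> T"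
  shows "S = T"
  using assms sccs_verts_eq[of S G x] sccs_verts_eq[of T G x] by (simp add: maximal_sccs_def)

text \<open>Choosing one index per member gives a hitting subset, so a minimal \<open>L\<close> is
  the image of any such choice, and disjointness makes the choice unique. Conversely, dropping the
  only index of a member leaves it unhit.\<close>

lemma minimal_hitting_iff_one_of_each:
  assumes disj: "\<And>S T x. S \<in> \<S> \<Longrightarrow> T \<in> \<S> \<Longrightarrow> x \<in> S \<Longrightarrow> x \<in> T \<Longrightarrow> S = T"
  shows "(\<forall>S\<in>\<S>. \<exists>l\<in>L. I l \<in> S) \<and> (\<forall>L'. (\<forall>S\<in>\<S>. \<exists>l\<in>L'. I l \<in> S) \<and> L' \<subseteq> L \<longrightarrow> L' = L) \<longleftrightarrow>
    one_of_each I L \<S>"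
proof
  assume *: "(\<forall>S\<in>\<S>. \<exists>l\<in>L. I l \<in> S) \<and> (\<forall>L'. (\<forall>S\<in>\<S>. \<exists>l\<in>L'. I l \<in> S) \<and> L' \<subseteq> L \<longrightarrow> L' = L)"
  then obtain f where f: "\<And>S. S \<in> \<S> \<Longrightarrow> f S \<in> L \<and> I (f S) \<in> S" by metis
  then have "\<forall>S\<in>\<S>. \<exists>l\<in>f ` \<S>. I l \<in> S" "f ` \<S> \<subseteq> L" by auto
  then have L: "f ` \<S> = L" using * by blast
  have "l = f S" if "S \<in> \<S>" "l \<in> L" "I l \<in> S" for S l
  proof -
    obtain T where T: "T \<in> \<S>" "l = f T" using \<open>l \<in> L\<close> L by blast
    then show ?thesis using disj[OF T(1) \<open>S \<in> \<S>\<close>, of "I l"] f[of T] \<open>I l \<in> S\<close> by simp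
  qed
  then have "\<exists>!l. l \<in> L \<and> I l \<in> S" if "S \<in> \<S>" for S
    using f[OF that] that by (intro ex1I[of _ "f S"]) auto
  moreover have "\<exists>S\<in>\<S>. I l \<in> S" if "l \<in> L" for l
    using f L that by blast
  ultimately show "one_of_each I L \<S>"
    by (simp add: one_of_each_def)
next
  assume *: "one_of_each I L \<S>"
  have "l \<in> L'" if L': "\<forall>S\<in>\<S>. \<exists>l\<in>L'. I l \<in> S" "L' \<subseteq> L" and l: "l \<in> L" for L' l
  proof -
    obtain S where S: "S \<in> \<S>" "I l \<in> S" using * l by (auto simp: one_of_each_def)
    then obtain l' where "l' \<in> L'" "I l' \<in> S" using L' by blast
    then have "l' = l" using * S l L'(2) unfolding one_of_each_def by blast
    then show ?thesis using \<open>l' \<in> L'\<close> by simp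
  qed
  then show "(\<forall>S\<in>\<S>. \<exists>l\<in>L. I l \<in> S) \<and> (\<forall>L'. (\<forall>S\<in>\<S>. \<exists>l\<in>L'. I l \<in> S) \<and> L' \<subseteq> L \<longrightarrow> L' = L)"
    using * unfolding one_of_each_def by blast
qed

section \<open>Both claims reduced to reachability from the nodes\<close>

theorem theorem6:
  fixes C \<D> :: "(ereal ^ 'n::finite) set"
    and a :: "'n tproj"
    and q :: nat
    and I :: "nat \<Rightarrow> 'n set"
    and \<Lambda> :: "(ereal ^ 'n) set set"
  assumes "real_polyhedral_cone C"
    and "a \<in> cone_boundary C"
    and "\<forall>l\<in>{1..q}. is_sectors (I l) \<and> halfspace a (I l) \<in> Sigma_at C a"
    and "finite \<Lambda>" and "\<Lambda> \<subseteq> Sigma_all C"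
    and "\<forall>b K. is_sectors K \<and> halfspace b K \<in> \<Lambda> \<longrightarrow> b \<noteq> a"
    and "\<D> = \<Inter>\<Lambda>"
    and "C - {maxplus_zero} = \<D> \<inter> (\<Inter>l\<in>{1..q}. halfspace a (I l))"
  shows "(a \<in> nonredundant_apices C \<longleftrightarrow> \<not> strongly_connected (reach_digraph C \<Lambda> a)) \<and>
    (a \<in> nonredundant_apices C \<longrightarrow>
      (\<forall>L \<subseteq> {1..q}.
        (sufficient_indices C \<Lambda> a I q L \<and>
          (\<forall>L'. sufficient_indices C \<Lambda> a I q L' \<and> L' \<subseteq> L \<longrightarrow> L' = L))
        \<longleftrightarrow> one_of_each I L (maximal_sccs (reach_digraph C \<Lambda> a))))"
proof -
  let ?C = "C - {maxplus_zero}"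
  let ?r = "hyper_reach (tangent_hypergraph \<Lambda> a)" and ?G = "reach_digraph C \<Lambda> a"
  obtain \<alpha> where \<alpha>: "a = abs_tproj \<alpha>" by (rule tproj_rep)
  have eq: "?C = \<Inter>\<Lambda> \<inter> (\<Inter>l\<in>{1..q}. halfspace a (I l))" using assms(7,8) by simp
  have I: "is_sectors (I l)" "?C \<subseteq> halfspace a (I l)" if "l \<in> {1..q}" for l
    using assms(3) that eq by auto
  have "\<Lambda> \<subseteq> (\<lambda>(b, K). halfspace b K) ` {(b, K). is_sectors K \<and> b \<in> proj_image C}"
    using assms(5) by (force simp: Sigma_all_def)
  then obtain Q where Q: "Q \<subseteq> {(b, K). is_sectors K \<and> b \<in> proj_image C}" "finite Q" "halfspaces Q = \<Lambda>"
    unfolding halfspaces_def using finite_subset_image[OF assms(4)] by metis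
  have sQ: "all_sectors Q" using Q(1) by (auto simp: all_sectors_def)
  let ?P = "Q \<union> (\<lambda>l. (a, I l)) ` {1..q}"
  have P: "\<Inter>(halfspaces ?P) = ?C"
    unfolding eq Q(3)[symmetric] by (auto simp: halfspaces_def)
  interpret represented_cone C ?P
    using sQ I P by unfold_locales (auto simp: all_sectors_def)
  have aC: "a \<in> proj_image C" using assms(2) cone_boundary_subset by blast
  interpret apex_represented_cone C ?P
    using Q(1,2) aC by unfold_locales auto
  have \<alpha>C: "real_vec \<alpha> \<in> ?C" using aC unfolding \<alpha> abs_in_proj_image_iff .
  then have \<alpha>\<Lambda>: "real_vec \<alpha> \<in> \<Inter>\<Lambda>" using eq by blast

  have reach: "\<Inter>\<Lambda> \<inter> (\<Inter>l\<in>L. halfspace a (I l)) \<subseteq> halfspace a J \<longleftrightarrow>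
      ?r J = UNIV \<or> (\<exists>l\<in>L. I l \<subseteq> ?r J)" if "L \<subseteq> {1..q}" "is_sectors J" for L J
    using Inter_subset_halfspace_iff_hyper_reach[OF assms(4,5) \<alpha>\<Lambda>, of "I ` L" J] that I
    unfolding \<alpha> by (auto simp: subset_iff)
  have nodes: "J \<in> reach_nodes C a \<longleftrightarrow> J = UNIV \<or> is_sectors J \<and> ?C \<subseteq> halfspace a J" for J
    by (auto simp: reach_nodes_def)
  have vertsG: "verts ?G = reach_nodes C a" by (simp add: reach_digraph_def)
  have reach_UNIV: "?r UNIV = UNIV" by (rule top.extremum_uniqueI[OF subset_hyper_reach])
  \<comment> \<open>\<open>UNIV\<close> is a node that contains, hence reaches, every node; so only
    reaching \<open>UNIV\<close> is in question.\<close>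
  have sc: "strongly_connected ?G \<longleftrightarrow> (\<forall>J\<in>reach_nodes C a. ?r J = UNIV)"
  proof
    assume *: "strongly_connected ?G"
    have "UNIV \<in> reach_nodes C a" by (simp add: nodes)
    then show "\<forall>J\<in>reach_nodes C a. ?r J = UNIV"
      using * unfolding strongly_connected_def vertsG reachable_reach_digraph_iff by blast
  next
    assume "\<forall>J\<in>reach_nodes C a. ?r J = UNIV"
    moreover have "reach_nodes C a \<noteq> {}" using nodes[of UNIV] by blast
    ultimately show "strongly_connected ?G"
      unfolding strongly_connected_def vertsG reachable_reach_digraph_iff by simp
  qed

  have i: "a \<in> nonredundant_apices C \<longleftrightarrow> \<not> strongly_connected ?G"
  proof
    assume a: "a \<in> nonredundant_apices C"
    show "\<not> strongly_connected ?G"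
    proof
      assume "strongly_connected ?G"
      \<comment> \<open>When all nodes reach \<open>UNIV\<close>, \<Lambda> alone implies the
        half-spaces at \<open>a\<close>, and the apices of \<open>Q\<close> form a generating set
        without \<open>a\<close>.\<close>
      then have "\<Inter>\<Lambda> \<subseteq> halfspace a (I l)" if "l \<in> {1..q}" for l
        using reach[of "{}" "I l"] I[OF that] nodes[of "I l"] sc by simp
      then have "\<Inter>(halfspaces Q) = ?C" using eq Q(3) by blast
      then have "generates_boundary C (fst ` Q)"
        by (rule generates_boundary_apices[OF Q(2) sQ]) (use Q(1) in auto)
      moreover have "a \<notin> fst ` Q"
        using assms(6) Q sQ unfolding halfspaces_def all_sectors_def by force
      ultimately show False using a unfolding nonredundant_apices_eq by blast
    qed
  next
    assume "\<not> strongly_connected ?G"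
    then obtain J where J: "J \<in> reach_nodes C a" "?r J \<noteq> UNIV" using sc by blast
    have "J \<noteq> UNIV" using J(2) reach_UNIV by auto
    then have J': "is_sectors J" "?C \<subseteq> halfspace a J" using nodes[of J] J(1) by simp_all
    have eqP: "halfspaces (presentations \<Lambda>) = \<Lambda>" by (rule halfspaces_presentations[OF assms(5)])
    have cl: "tangent_closed \<alpha> (presentations \<Lambda>) (?r J)"
      unfolding tangent_closed_presentations_iff[OF \<alpha>\<Lambda>] \<alpha> using hyper_reach_closed by blast
    \<comment> \<open>\<open>?r J\<close> is a proper closed set containing \<open>J\<close>, which
      is impossible if some generating set avoids \<open>a\<close>.\<close>
    have "a \<in> Y" if Y: "generates_boundary C Y" for Y
    proof (rule ccontr)
      assume "a \<notin> Y"
      have "\<not> J \<subseteq> ?r J"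
      proof (rule no_sectors_in_tangent_closed_generating[OF Y])
        show "abs_tproj \<alpha> \<in> cone_boundary C" "abs_tproj \<alpha> \<notin> Y"
          using assms(2) \<open>a \<notin> Y\<close> by (simp_all add: \<alpha>)
        show "?C = \<Inter>(halfspaces (presentations \<Lambda>)) \<inter> (\<Inter>J\<in>I ` {1..q}. halfspace (abs_tproj \<alpha>) J)"
          unfolding eqP eq \<alpha> by simp
        show "?C \<subseteq> halfspace (abs_tproj \<alpha>) J" using J'(2) by (simp add: \<alpha>)
        show "finite (halfspaces (presentations \<Lambda>))" using assms(4) by (simp add: eqP)
      qed (use all_sectors_presentations I(1) cl J(2) J'(1) in auto)
      then show False using subset_hyper_reach[of J] by blast
    qed
    then show "a \<in> nonredundant_apices C" unfolding nonredundant_apices_eq by blast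
  qed

  have ii: "(sufficient_indices C \<Lambda> a I q L \<and>
          (\<forall>L'. sufficient_indices C \<Lambda> a I q L' \<and> L' \<subseteq> L \<longrightarrow> L' = L))
        \<longleftrightarrow> one_of_each I L (maximal_sccs ?G)"
    if nsc: "\<not> strongly_connected ?G" and L: "L \<subseteq> {1..q}" for L
  proof -
    define hits where "hits L \<longleftrightarrow> (\<forall>S\<in>maximal_sccs ?G. \<exists>l\<in>L. I l \<in> S)" for L
    have "sufficient_indices C \<Lambda> a I q L \<longleftrightarrow> (\<forall>S\<in>maximal_sccs ?G. \<exists>l\<in>L. I l \<in> S)"
      if L: "L \<subseteq> {1..q}" for L
    proof -
      have IL: "I l \<in> reach_nodes C a" if "l \<in> L" for l
        using I[of l] L that nodes[of "I l"] by blast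
      let ?H = "\<lambda>L. \<Lambda> \<union> (\<lambda>l. halfspace a (I l)) ` L"
      have H: "\<Inter>(?H L) = \<Inter>\<Lambda> \<inter> (\<Inter>l\<in>L. halfspace a (I l))" for L by auto
      have "halfspace a (I l) \<in> Sigma_all C" if "l \<in> {1..q}" for l
        unfolding Sigma_all_def using I[OF that] aC by blast
      then have "?H {1..q} \<subseteq> Sigma_all C" using assms(5) by blast
      moreover have Hq: "\<Inter>(?H {1..q}) = ?C" unfolding H eq ..
      ultimately have tau_iff: "tau C \<Gamma> = Sigma_all C \<longleftrightarrow> \<Inter>\<Gamma> \<subseteq> ?C" for \<Gamma>
        by (intro tau_eq_Sigma_all_iff)
      have "tau C (?H {1..q}) = Sigma_all C" unfolding tau_iff Hq ..
      then have "sufficient_indices C \<Lambda> a I q L \<longleftrightarrow> \<Inter>(?H L) \<subseteq> ?C"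
        using tau_iff[of "?H L"] L unfolding sufficient_indices_def by argo
      \<comment> \<open>The intersection lies in that of \<Lambda> anyway, so containment in the
        cone need only be tested against half-spaces with apex \<open>a\<close>.\<close>
      also have "\<dots> \<longleftrightarrow> (\<forall>J. is_sectors J \<and> ?C \<subseteq> halfspace a J \<longrightarrow> \<Inter>(?H L) \<subseteq> halfspace a J)"
      proof
        assume *: "\<forall>J. is_sectors J \<and> ?C \<subseteq> halfspace a J \<longrightarrow> \<Inter>(?H L) \<subseteq> halfspace a J"
        then have "\<Inter>(?H L) \<subseteq> halfspace a (I l)" if "l \<in> {1..q}" for l using I[OF that] by blast
        moreover have "\<Inter>(?H L) \<subseteq> \<Inter>\<Lambda>" by blast
        ultimately show "\<Inter>(?H L) \<subseteq> ?C" unfolding eq by blast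
      qed blast
      also have "\<dots> \<longleftrightarrow> (\<forall>J\<in>reach_nodes C a - {UNIV}. ?r J = UNIV \<or> (\<exists>l\<in>L. I l \<subseteq> ?r J))"
      proof -
        have "reach_nodes C a - {UNIV} = {J. is_sectors J \<and> ?C \<subseteq> halfspace a J}"
          by (auto simp: nodes is_sectors_def)
        then show ?thesis unfolding H using reach[OF L] by (metis (no_types, lifting) mem_Collect_eq)
      qed
      also have "\<dots> \<longleftrightarrow> (\<forall>J\<in>reach_nodes C a. \<exists>l\<in>L. I l \<subseteq> ?r J)"
      proof
        assume *: "\<forall>J\<in>reach_nodes C a - {UNIV}. ?r J = UNIV \<or> (\<exists>l\<in>L. I l \<subseteq> ?r J)"
        \<comment> \<open>Here the failure of strong connectivity enters: for empty \<open>L\<close>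
          every node would reach \<open>UNIV\<close>. Any index in \<open>L\<close> then serves for
          the nodes with \<open>?r J = UNIV\<close>.\<close>
        have "L \<noteq> {}"
        proof
          assume "L = {}"
          then have "?r J = UNIV" if "J \<in> reach_nodes C a" for J
            using * that reach_UNIV by (cases "J = UNIV") auto
          then show False using nsc sc by simp
        qed
        then obtain l where "l \<in> L" by blast
        show "\<forall>J\<in>reach_nodes C a. \<exists>l\<in>L. I l \<subseteq> ?r J"
        proof
          fix J assume "J \<in> reach_nodes C a"
          then have "?r J = UNIV \<or> (\<exists>l\<in>L. I l \<subseteq> ?r J)"
            using * reach_UNIV by (cases "J = UNIV") auto
          then show "\<exists>l\<in>L. I l \<subseteq> ?r J" using \<open>l \<in> L\<close> by auto
        qed
      qed blast
      also have "\<dots> \<longleftrightarrow> (\<forall>J\<in>verts ?G. \<exists>l\<in>L. reachable ?G J (I l))"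
        unfolding vertsG reachable_reach_digraph_iff by (simp add: IL cong: ball_cong bex_cong)
      also have "\<dots> \<longleftrightarrow> (\<forall>S\<in>maximal_sccs ?G. \<exists>l\<in>L. I l \<in> S)"
        by (rule cofinal_iff_meets_maximal_sccs) (auto simp: vertsG IL)
      finally show ?thesis .
    qed
    \<comment> \<open>Minimality compares only subsets of \<open>L\<close>, all within
      \<open>{1..q}\<close>, where sufficiency and hitting agree.\<close>
    then have "sufficient_indices C \<Lambda> a I q L' \<longleftrightarrow> hits L'" if "L' \<subseteq> L" for L'
      using order_trans[OF that L] by (simp add: hits_def)
    then have "(sufficient_indices C \<Lambda> a I q L \<and>
          (\<forall>L'. sufficient_indices C \<Lambda> a I q L' \<and> L' \<subseteq> L \<longrightarrow> L' = L)) \<longleftrightarrow>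
        hits L \<and> (\<forall>L'. hits L' \<and> L' \<subseteq> L \<longrightarrow> L' = L)"
      by (metis order_refl)
    also have "\<dots> \<longleftrightarrow> one_of_each I L (maximal_sccs ?G)"
      unfolding hits_def by (rule minimal_hitting_iff_one_of_each) (rule maximal_sccs_disjoint)
    finally show ?thesis .
  qed
  show ?thesis using i ii by blast
qed

end
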